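(* Let $T:\mathcal{M}_d\to\mathcal{M}_d$ be a doubly stochastic quantum channel such that $T^*T$ is primitive. Then $\|T\|_{2\to q,\frac{\mathbb{1}_d}{d}}\leq1$ for all $q\leq 2+2\alpha_D(T)$.
   Context: Doubly stochastic channel: completely positive, trace preserving, $T(\mathbb{1})=T^*(\mathbb{1})=\mathbb{1}$. A doubly stochastic channel $S$ is primitive if $S^k(\rho)\to\mathbb{1}_d/d$ for all states. Weighted norm $\|Y\|_{p,\frac{\mathbb{1}_d}{d}}=d^{-1/p}(\text{tr}|Y|^p)^{1/p}$ and $\|T\|_{2\to q,\frac{\mathbb{1}_d}{d}}=\sup_{X\neq0}\|T(X)\|_{q,\frac{\mathbb{1}_d}{d}}/\|X\|_{2,\frac{\mathbb{1}_d}{d}}$. Discrete LS constant $\alpha_D(T)=\frac12\alpha_2(T^*T-\text{id}_d)$, where $\alpha_2(\mathcal{L})=\inf_{X>0}\mathcal{E}^2_{\mathcal{L}}(X)/\text{Ent}_2(X)$ over positive definite $X$, $\mathcal{E}^2_{\mathcal{L}}(X)=-\frac1d\text{tr}[\mathcal{L}(X)X]$, $\text{Ent}_2(X)=\frac1{2d}\text{tr}[X^2(\log\frac{X^2}{\text{tr}(X^2)}+\log d)]$. *)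

theory Defs
  imports "Jordan_Normal_Form.Spectral_Radius" "Jordan_Normal_Form.Schur_Decomposition"
begin

definition mtrace :: "complex mat \<Rightarrow> complex" where
  "mtrace A = (\<Sum>i<dim_row A. A $$ (i,i))"

definition eigvals :: "complex mat \<Rightarrow> complex list" where
  "eigvals A = (SOME as. char_poly A = (\<Prod>a\<leftarrow>as. [:- a, 1:]) \<and> length as = dim_row A)"

definition psd_mat :: "nat \<Rightarrow> complex mat \<Rightarrow> bool" where
  "psd_mat d A \<longleftrightarrow> A \<in> carrier_mat d d \<and> mat_adjoint A = A \<and>
     (\<forall>v \<in> carrier_vec d. 0 \<le> Re ((A *\<^sub>v v) \<bullet>c v))"

definition pd_mat :: "nat \<Rightarrow> complex mat \<Rightarrow> bool" where
  "pd_mat d A \<longleftrightarrow> A \<in> carrier_mat d d \<and> mat_adjoint A = A \<and>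
     (\<forall>v \<in> carrier_vec d. v \<noteq> 0\<^sub>v d \<longrightarrow> 0 < Re ((A *\<^sub>v v) \<bullet>c v))"

definition is_state :: "nat \<Rightarrow> complex mat \<Rightarrow> bool" where
  "is_state d \<rho> \<longleftrightarrow> psd_mat d \<rho> \<and> mtrace \<rho> = 1"

definition linear_map :: "nat \<Rightarrow> (complex mat \<Rightarrow> complex mat) \<Rightarrow> bool" where
  "linear_map d T \<longleftrightarrow>
     (\<forall>A \<in> carrier_mat d d. T A \<in> carrier_mat d d) \<and>
     (\<forall>A \<in> carrier_mat d d. \<forall>B \<in> carrier_mat d d. T (A + B) = T A + T B) \<and>
     (\<forall>c. \<forall>A \<in> carrier_mat d d. T (c \<cdot>\<^sub>m A) = c \<cdot>\<^sub>m T A)"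

text \<open>Block matrix in M_n(M_d) = M_d \<otimes> M_n, assembled as an (n*d) x (n*d) matrix.\<close>
definition block_mat :: "nat \<Rightarrow> nat \<Rightarrow> (nat \<Rightarrow> nat \<Rightarrow> complex mat) \<Rightarrow> complex mat" where
  "block_mat n d X = mat (n*d) (n*d) (\<lambda>(a,b). X (a div d) (b div d) $$ (a mod d, b mod d))"

definition completely_positive :: "nat \<Rightarrow> (complex mat \<Rightarrow> complex mat) \<Rightarrow> bool" where
  "completely_positive d T \<longleftrightarrow>
     (\<forall>n X. (\<forall>i<n. \<forall>j<n. X i j \<in> carrier_mat d d) \<and> psd_mat (n*d) (block_mat n d X) \<longrightarrow>
        psd_mat (n*d) (block_mat n d (\<lambda>i j. T (X i j))))"

definition mat_unit :: "nat \<Rightarrow> nat \<Rightarrow> nat \<Rightarrow> complex mat" where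
  "mat_unit d i j = mat d d (\<lambda>(k,l). if k = i \<and> l = j then 1 else 0)"

text \<open>Adjoint w.r.t. the Hilbert-Schmidt inner product tr(A^* B):
  T^*(Y)_{ij} = tr(T(E_ij)^* Y).\<close>
definition hs_adjoint :: "nat \<Rightarrow> (complex mat \<Rightarrow> complex mat) \<Rightarrow> complex mat \<Rightarrow> complex mat" where
  "hs_adjoint d T Y = mat d d (\<lambda>(i,j). mtrace (mat_adjoint (T (mat_unit d i j)) * Y))"

definition doubly_stochastic :: "nat \<Rightarrow> (complex mat \<Rightarrow> complex mat) \<Rightarrow> bool" where
  "doubly_stochastic d T \<longleftrightarrow> linear_map d T \<and> completely_positive d T \<and>
     (\<forall>X \<in> carrier_mat d d. mtrace (T X) = mtrace X) \<and>
     T (1\<^sub>m d) = 1\<^sub>m d \<and> hs_adjoint d T (1\<^sub>m d) = 1\<^sub>m d"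

definition primitive :: "nat \<Rightarrow> (complex mat \<Rightarrow> complex mat) \<Rightarrow> bool" where
  "primitive d S \<longleftrightarrow> doubly_stochastic d S \<and>
     (\<forall>\<rho>. is_state d \<rho> \<longrightarrow>
        (\<forall>i<d. \<forall>j<d. (\<lambda>k. (S ^^ k) \<rho> $$ (i,j)) \<longlonglongrightarrow> ((1 / of_nat d) \<cdot>\<^sub>m 1\<^sub>m d) $$ (i,j)))"

text \<open>Weighted Schatten norm ||Y||_{p,1/d} = d^{-1/p} (tr |Y|^p)^{1/p};
  tr |Y|^p is the sum of the p/2-th powers of the eigenvalues of Y^* Y.\<close>
definition wnorm :: "nat \<Rightarrow> real \<Rightarrow> complex mat \<Rightarrow> real" where
  "wnorm d p Y = (real d) powr (-1/p) *
     (\<Sum>e\<leftarrow>eigvals (mat_adjoint Y * Y). (Re e) powr (p/2)) powr (1/p)"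

definition norm_2_to_q :: "nat \<Rightarrow> real \<Rightarrow> (complex mat \<Rightarrow> complex mat) \<Rightarrow> real" where
  "norm_2_to_q d q T = Sup {wnorm d q (T X) / wnorm d 2 X | X. X \<in> carrier_mat d d \<and> X \<noteq> 0\<^sub>m d d}"

definition dirichlet2 :: "nat \<Rightarrow> (complex mat \<Rightarrow> complex mat) \<Rightarrow> complex mat \<Rightarrow> real" where
  "dirichlet2 d L X = - (1 / real d) * Re (mtrace (L X * X))"

text \<open>Ent_2(X) = 1/(2d) tr[X^2 (log X^2 - log tr X^2 + log d)], written via the spectral
  decomposition of the positive definite X (eigenvalues \<lambda>, tr f(X) = \<Sum> f(\<lambda>)).\<close>
definition ent2 :: "nat \<Rightarrow> complex mat \<Rightarrow> real" where
  "ent2 d X = (1 / (2 * real d)) *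
     (\<Sum>e\<leftarrow>eigvals X. (Re e)\<^sup>2 * (ln ((Re e)\<^sup>2) - ln (Re (mtrace (X * X))) + ln (real d)))"

text \<open>LS constant; the infimum ranges over positive definite X with Ent_2(X) \<noteq> 0
  (the quotient is undefined otherwise).\<close>
definition alpha2 :: "nat \<Rightarrow> (complex mat \<Rightarrow> complex mat) \<Rightarrow> real" where
  "alpha2 d L = Inf {dirichlet2 d L X / ent2 d X | X. pd_mat d X \<and> ent2 d X \<noteq> 0}"

definition alphaD :: "nat \<Rightarrow> (complex mat \<Rightarrow> complex mat) \<Rightarrow> real" where
  "alphaD d T = (1/2) * alpha2 d (\<lambda>X. hs_adjoint d T (T X) - X)"

end

(*
Write ^H for adjoints and X = sum_i s_i w_i x_i^H in singular value form. For an orthonormal basis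
u the numbers P_ji = <T(w_i w_i^H) u_j, u_j> form a doubly stochastic kernel. If sigma_j are the
singular values of T(X), with left and right singular bases u and v, then 2-positivity of T gives
sigma_j^2 <= (P s)_j (P' s)_j, where P and P' are the kernels of (w, u) and (x, v). With r = q/2,
Jensen turns this into sigma_j^q <= (P s^r)_j (P' s^r)_j, so it suffices to bound sum_j (P
s^r)_j^2, which is at most tr T(Y)^2 for Y = (X X^H)^{r/2}. The log-Sobolev inequality for T^H T -
id at Y bounds this by tr Y^2 - alpha_2 d Ent_2(Y), and by convexity of the exponential function
this is at most d (sum_i s_i^2 / d)^r as soon as q <= 2 + alpha_2. Singular values equal to 0 are
reached by continuity.
*)

theory Submission
  imports Defs
begin

section \<open>Orthonormal bases, the spectral theorem and singular values\<close>

text \<open>The log-Sobolev constant sees only positive definite matrices, while the norm is a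
  supremum over all X. Passing to |X^H| = (X X^H)^{1/2} and |X| = (X^H X)^{1/2} removes this gap at
  the price of two kernels. The inequality 2ab <= a^2 + b^2 splits their products into one sum per
  kernel, and both sums obey the same bound because |X^H|^r and |X|^r have the same eigenvalues.
  Only Hilbert-Schmidt norms have to be controlled after that: since <T^H T Y, Y> = ||T Y||^2, the
  Dirichlet form of T^H T - id is 1/d times the loss of squared Hilbert-Schmidt norm under T. The
  comparison of tr Y^2 with tr |X|^2 is made in one stroke at the fixed exponent r, so no norm is
  differentiated with respect to its exponent. Exponents q <= 2 require no entropy: normalised power
  means increase with the exponent, and T contracts the 2-norm.\<close>

definition ip :: "nat \<Rightarrow> (nat \<Rightarrow> complex) \<Rightarrow> (nat \<Rightarrow> complex) \<Rightarrow> complex" where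
  "ip d x y = (\<Sum>a<d. x a * cnj (y a))"

text \<open>Vectors are plain functions of which only the values below \<open>d\<close> matter, so
  single basis vectors can be replaced by function update. The index set is arbitrary because
  partial systems occur in two shapes: initial segments in the spectral theorem, and the indices of
  nonzero singular values.\<close>

definition orthonormal_on :: "nat \<Rightarrow> nat set \<Rightarrow> (nat \<Rightarrow> nat \<Rightarrow> complex) \<Rightarrow> bool" where
  "orthonormal_on d J u \<longleftrightarrow> (\<forall>i\<in>J. \<forall>j\<in>J. ip d (u i) (u j) = of_bool (i = j))"

abbreviation onb :: "nat \<Rightarrow> (nat \<Rightarrow> nat \<Rightarrow> complex) \<Rightarrow> bool" where
  "onb d \<equiv> orthonormal_on d {..<d}"

lemma ip_commute: "ip d y x = cnj (ip d x y)"
  by (simp add: ip_def mult.commute)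

lemma ip_self: "ip d x x = of_real (\<Sum>a<d. (cmod (x a))\<^sup>2)"
  by (simp only: ip_def of_real_sum complex_norm_square)

lemma ip_eq_cscalar_prod:
  assumes "v \<in> carrier_vec d" "w \<in> carrier_vec d"
  shows "v \<bullet>c w = ip d (vec_index v) (vec_index w)"
  using assms by (auto simp: ip_def scalar_prod_def atLeast0LessThan intro!: sum.cong)

text \<open>Orthonormality says that the square matrix with rows \<open>u i\<close> has its adjoint
  as a right inverse. It is then also a left inverse, and this is the resolution of the
  identity.\<close>

lemma onb_complete:
  assumes "onb d u" "a < d" "b < d"
  shows "(\<Sum>i<d. u i a * cnj (u i b)) = of_bool (a = b)"
proof -
  let ?V = "mat d d (\<lambda>(i,a). u i a)" and ?W = "mat d d (\<lambda>(a,i). cnj (u i a))"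
  have "?V * ?W = 1\<^sub>m d"
    using assms(1)
    by (intro eq_matI) (auto simp: scalar_prod_def orthonormal_on_def ip_def atLeast0LessThan)
  then have "?W * ?V = 1\<^sub>m d"
    by (intro mat_mult_left_right_inverse[of ?V d ?W]) auto
  then have "(?W * ?V) $$ (b, a) = 1\<^sub>m d $$ (b, a)" by simp
  then show ?thesis
    using assms(2,3) by (auto simp: scalar_prod_def atLeast0LessThan mult.commute)
qed

lemma onb_expansion:
  assumes "onb d u" "a < d"
  shows "x a = (\<Sum>i<d. ip d x (u i) * u i a)"
proof -
  have "(\<Sum>i<d. ip d x (u i) * u i a) = (\<Sum>i<d. \<Sum>b<d. x b * (u i a * cnj (u i b)))"
    by (simp add: ip_def sum_distrib_right sum_distrib_left mult_ac)
  also have "\<dots> = (\<Sum>b<d. x b * (\<Sum>i<d. u i a * cnj (u i b)))"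
    by (subst sum.swap) (simp add: sum_distrib_left)
  also have "\<dots> = (\<Sum>b<d. x b * of_bool (a = b))"
    using assms by (intro sum.cong) (auto simp: onb_complete)
  also have "\<dots> = x a"
    using assms(2) by (simp add: of_bool_def if_distrib sum.delta' cong: if_cong)
  finally show ?thesis by simp
qed

lemma onb_parseval:
  assumes "onb d u"
  shows "(\<Sum>i<d. (cmod (ip d x (u i)))\<^sup>2) = (\<Sum>a<d. (cmod (x a))\<^sup>2)"
proof -
  have "complex_of_real (\<Sum>a<d. (cmod (x a))\<^sup>2) = (\<Sum>a<d. x a * cnj (x a))"
    by (simp only: ip_self[symmetric] ip_def)
  also have "\<dots> = (\<Sum>a<d. (\<Sum>i<d. ip d x (u i) * u i a) * cnj (x a))"
    using onb_expansion[OF assms, of _ x] by (intro sum.cong) auto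
  also have "\<dots> = (\<Sum>i<d. \<Sum>a<d. ip d x (u i) * (u i a * cnj (x a)))"
    by (subst sum.swap) (simp add: sum_distrib_right mult.assoc)
  also have "\<dots> = (\<Sum>i<d. ip d x (u i) * ip d (u i) x)"
    by (simp add: ip_def sum_distrib_left)
  also have "\<dots> = (\<Sum>i<d. of_real ((cmod (ip d x (u i)))\<^sup>2))"
    unfolding complex_norm_square by (simp only: ip_commute[of d _ x])
  finally show ?thesis unfolding of_real_sum[symmetric] of_real_eq_iff by simp
qed

text \<open>The orthogonality conditions form a square linear system whose rows outside
  \<open>J\<close> are zero. Its transpose kills a unit vector, so the determinant vanishes and the
  system has a nonzero solution, which is then normalised.\<close>

lemma exists_orthogonal_unit:
  assumes "J \<subseteq> {..<d}" "J \<noteq> {..<d}"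
  shows "\<exists>v. ip d v v = 1 \<and> (\<forall>i\<in>J. ip d v (u i) = 0)"
proof -
  let ?M = "mat d d (\<lambda>(i,a). if i \<in> J then cnj (u i a) else 0)"
  obtain j where j: "j < d" "j \<notin> J" using assms by auto
  have "det ?M = 0"
  proof -
    have "transpose_mat ?M *\<^sub>v unit_vec d j = 0\<^sub>v d"
      using j by (intro eq_vecI) (auto simp: scalar_prod_def unit_vec_def)
    moreover have "unit_vec d j \<noteq> (0\<^sub>v d :: complex vec)"
      using j(1) by (metis index_unit_vec(1) index_zero_vec(1) zero_neq_one)
    ultimately have "det (transpose_mat ?M) = 0"
      using iffD2[OF det_0_iff_vec_prod_zero[of "transpose_mat ?M" d]] unit_vec_carrier[of d j]
        mat_carrier[of d d] transpose_carrier_mat by blast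
    then show ?thesis by (subst det_transpose[of _ d, symmetric]) auto
  qed
  then obtain v where v: "v \<in> carrier_vec d" "v \<noteq> 0\<^sub>v d" "?M *\<^sub>v v = 0\<^sub>v d"
    using det_0_iff_vec_prod_zero[of ?M d] by auto
  define N where "N = sqrt (\<Sum>a<d. (cmod (v $ a))\<^sup>2)"
  obtain a where a: "a < d" "v $ a \<noteq> 0"
    using v(1,2) by (metis carrier_vecD eq_vecI index_zero_vec)
  have pos: "(\<Sum>a<d. (cmod (v $ a))\<^sup>2) > 0"
    using a by (intro sum_pos2[of _ a]) auto
  then have N: "N > 0" "N\<^sup>2 = (\<Sum>a<d. (cmod (v $ a))\<^sup>2)" by (auto simp: N_def)
  let ?v = "\<lambda>a. v $ a / of_real N"
  have "ip d ?v ?v = 1"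
    unfolding ip_self using N(1) pos
    by (simp add: norm_divide power_divide N(2)[symmetric] flip: sum_divide_distrib)
  moreover have "ip d ?v (u i) = 0" if "i \<in> J" for i
  proof -
    have "(?M *\<^sub>v v) $ i = 0" using v(3) that assms(1) by auto
    then have "(\<Sum>a<d. cnj (u i a) * v $ a) = 0"
      using that v(1) assms(1) by (auto simp: scalar_prod_def atLeast0LessThan)
    then show ?thesis
      by (simp add: ip_def mult.commute flip: sum_divide_distrib)
  qed
  ultimately show ?thesis by blast
qed

lemma orthonormal_on_extend:
  assumes "J \<subseteq> {..<d}" "orthonormal_on d J u"
  shows "\<exists>u'. onb d u' \<and> (\<forall>i\<in>J. u' i = u i)"
  using assms
proof (induction "card ({..<d} - J)" arbitrary: J u)
  case 0
  then have "J = {..<d}" by auto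
  with 0 show ?case by blast
next
  case (Suc n)
  then have ne: "J \<noteq> {..<d}" by auto
  with Suc.prems(1) obtain j where j: "j < d" "j \<notin> J" by auto
  obtain v where v: "ip d v v = 1" "\<forall>i\<in>J. ip d v (u i) = 0"
    using exists_orthogonal_unit[OF Suc.prems(1) ne] by blast
  have v': "\<forall>i\<in>J. ip d (u i) v = 0" using v(2) by (metis ip_commute complex_cnj_zero)
  let ?J = "insert j J" and ?u = "u(j := v)"
  have "{..<d} - ?J = ({..<d} - J) - {j}" by auto
  then have "n = card ({..<d} - ?J)" using j Suc.hyps(2) by (simp add: card_Diff_singleton)
  moreover have "orthonormal_on d ?J ?u"
    using Suc.prems(2) v v' j by (auto simp: orthonormal_on_def)
  ultimately obtain u' where "onb d u'" "\<forall>i\<in>?J. u' i = ?u i"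
    using Suc.hyps(1)[of ?J ?u] Suc.prems(1) j by auto
  then show ?case using j by (intro exI[of _ u']) auto
qed

lemma eq_if_ip_eq:
  assumes "onb d u" "\<And>i. i < d \<Longrightarrow> ip d x (u i) = ip d y (u i)" "a < d"
  shows "x a = y a"
  using onb_expansion[OF assms(1,3), of x] onb_expansion[OF assms(1,3), of y] assms(2) by simp

section \<open>Matrices acting on functions, and the spectral theorem\<close>

definition app :: "nat \<Rightarrow> (nat \<Rightarrow> nat \<Rightarrow> complex) \<Rightarrow> (nat \<Rightarrow> complex) \<Rightarrow> nat \<Rightarrow> complex" where
  "app d H x a = (\<Sum>b<d. H a b * x b)"

lemma ip_app_adjoint: "ip d (app d H x) y = ip d x (app d (\<lambda>a b. cnj (H b a)) y)"
proof -
  have "ip d (app d H x) y = (\<Sum>a<d. \<Sum>b<d. H a b * x b * cnj (y a))"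
    by (simp add: ip_def app_def sum_distrib_right)
  also have "\<dots> = (\<Sum>b<d. \<Sum>a<d. H a b * x b * cnj (y a))" by (rule sum.swap)
  also have "\<dots> = ip d x (app d (\<lambda>a b. cnj (H b a)) y)"
    by (simp add: ip_def app_def sum_distrib_left mult_ac)
  finally show ?thesis .
qed

lemma ip_scale_left: "ip d (\<lambda>a. c * x a) y = c * ip d x y"
  by (simp add: ip_def sum_distrib_left mult_ac)

lemma ip_scale_right: "ip d x (\<lambda>a. c * y a) = cnj c * ip d x y"
  by (simp add: ip_def sum_distrib_left mult_ac)

lemma ip_sum_left: "ip d (\<lambda>a. \<Sum>i\<in>I. f i a) y = (\<Sum>i\<in>I. ip d (f i) y)"
  by (simp add: ip_def sum_distrib_right sum.swap[of _ I])

lemma ip_cong: "(\<And>a. a < d \<Longrightarrow> x a = x' a) \<Longrightarrow> (\<And>a. a < d \<Longrightarrow> y a = y' a) \<Longrightarrow> ip d x y = ip d x' y'"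
  by (simp add: ip_def)

lemma app_sum: "app d H (\<lambda>b. \<Sum>i\<in>I. f i b) a = (\<Sum>i\<in>I. app d H (f i) a)"
  by (simp add: app_def sum_distrib_left sum.swap[of _ I])

lemma app_scale: "app d H (\<lambda>b. c * x b) a = c * app d H x a"
  by (simp add: app_def sum_distrib_left mult_ac)

lemma exists_eigenvector:
  assumes "0 < n"
  shows "\<exists>x \<mu>. (\<exists>a<n. x a \<noteq> 0) \<and> (\<forall>a<n. app n H x a = \<mu> * x a)"
proof -
  let ?M = "mat n n (\<lambda>(a,b). H a b)"
  obtain \<mu> where "eigenvalue ?M \<mu>"
    using spectrum_non_empty[of ?M n] assms by (auto simp: spectrum_def)
  then obtain v where v: "v \<in> carrier_vec n" "v \<noteq> 0\<^sub>v n" "?M *\<^sub>v v = \<mu> \<cdot>\<^sub>v v"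
    by (auto simp: eigenvalue_def eigenvector_def)
  have "app n H (vec_index v) a = \<mu> * v $ a" if "a < n" for a
  proof -
    have "(?M *\<^sub>v v) $ a = (\<mu> \<cdot>\<^sub>v v) $ a" using v(3) by simp
    then show ?thesis using v(1) that by (auto simp: app_def scalar_prod_def atLeast0LessThan)
  qed
  moreover have "\<exists>a<n. v $ a \<noteq> 0"
    using v(1,2) by (metis carrier_vecD eq_vecI index_zero_vec)
  ultimately show ?thesis by blast
qed

text \<open>The count \<open>k\<close> exists for the induction; the spectral theorem is the case
  \<open>k = d\<close>. Given \<open>k\<close> orthonormal eigenvectors, extend them to a basis. A
  Hermitian \<open>H\<close> leaves the orthogonal complement of their span invariant, so an
  eigenvector of the compression of \<open>H\<close> to that complement is an eigenvector of
  \<open>H\<close>.\<close>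

lemma spectral_partial:
  assumes herm: "\<And>a b. a < d \<Longrightarrow> b < d \<Longrightarrow> H b a = cnj (H a b)"
  shows "k \<le> d \<Longrightarrow> \<exists>u \<mu>. orthonormal_on d {..<k} u \<and> (\<forall>i<k. \<forall>a<d. app d H (u i) a = \<mu> i * u i a)"
proof (induction k)
  case 0
  then show ?case by (auto simp: orthonormal_on_def)
next
  case (Suc k)
  then obtain u0 \<mu> where u0: "orthonormal_on d {..<k} u0"
    "\<forall>i<k. \<forall>a<d. app d H (u0 i) a = \<mu> i * u0 i a" by auto
  obtain u where u: "onb d u" "\<forall>i<k. u i = u0 i"
    using orthonormal_on_extend[OF _ u0(1)] Suc.prems by auto
  have eig: "app d H (u i) a = \<mu> i * u i a" if "i < k" "a < d" for i a using u0(2) u(2) that by auto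
  have ipu: "ip d (u i) (u j) = of_bool (i = j)" if "i < d" "j < d" for i j
    using u(1) that by (auto simp: orthonormal_on_def)
  have adj: "ip d (app d H x) y = ip d x (app d H y)" for x y
    unfolding ip_app_adjoint by (rule ip_cong) (auto simp: app_def herm[symmetric])
  define n where "n = d - k"
  have n: "0 < n" "k + n = d" using Suc.prems by (auto simp: n_def)
  obtain x \<nu> where x: "\<exists>a<n. x a \<noteq> 0"
    "\<And>l. l < n \<Longrightarrow> app n (\<lambda>l m. ip d (app d H (u (k+m))) (u (k+l))) x l = \<nu> * x l"
    using exists_eigenvector[OF n(1)] by blast
  \<comment> \<open>\<open>x\<close> is an eigenvector of the compressed matrix of size
    \<open>d - k\<close>, and \<open>y\<close> is the vector that has \<open>x\<close> as its
    coordinates in the remaining basis vectors.\<close>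
  define y where "y a = (\<Sum>m<n. x m * u (k+m) a)" for a
  have ipy: "ip d y (u j) = (if j < k then 0 else x (j - k))" if "j < d" for j
  proof -
    have "ip d y (u j) = (\<Sum>m<n. x m * of_bool (k + m = j))"
      unfolding y_def using that n by (simp add: ip_sum_left ip_scale_left ipu)
    also have "\<dots> = (\<Sum>m<n. if m = j - k then (if j < k then 0 else x m) else 0)"
      by (intro sum.cong) auto
    finally show ?thesis using that n by (auto simp: sum.delta)
  qed
  \<comment> \<open>Compare coefficients in the basis \<open>u\<close>. For \<open>j < k\<close>
    both sides vanish by moving \<open>H\<close> onto the eigenvector \<open>u j\<close>; for
    \<open>j \<ge> k\<close> this is the eigenvalue equation of the compression.\<close>
  have Hy: "app d H y a = \<nu> * y a" if "a < d" for a
  proof (rule eq_if_ip_eq[OF u(1) _ that])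
    fix j assume j: "j < d"
    show "ip d (app d H y) (u j) = ip d (\<lambda>a. \<nu> * y a) (u j)"
    proof (cases "j < k")
      case True
      have "ip d (app d H y) (u j) = ip d y (\<lambda>a. \<mu> j * u j a)"
        unfolding adj using True eig by (intro ip_cong) auto
      then show ?thesis using True j ipy by (simp add: ip_scale_left ip_scale_right)
    next
      case False
      have "ip d (app d H y) (u j) = (\<Sum>m<n. x m * ip d (app d H (u (k+m))) (u j))"
        unfolding y_def app_sum app_scale by (simp add: ip_sum_left ip_scale_left app_sum app_scale)
      also have "\<dots> = app n (\<lambda>l m. ip d (app d H (u (k+m))) (u (k+l))) x (j - k)"
        using False by (simp add: app_def mult.commute)
      also have "\<dots> = \<nu> * x (j - k)" using False j n by (intro x(2)) auto
      finally show ?thesis using False j ipy by (simp add: ip_scale_left)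
    qed
  qed
  define N where "N = sqrt (\<Sum>a<d. (cmod (y a))\<^sup>2)"
  have "(\<Sum>a<d. (cmod (y a))\<^sup>2) > 0"
  proof -
    obtain l where l: "l < n" "x l \<noteq> 0" using x(1) by auto
    have "(\<Sum>i<d. (cmod (ip d y (u i)))\<^sup>2) > 0"
      using l n ipy[of "k + l"] by (intro sum_pos2[of _ "k+l"]) auto
    then show ?thesis by (simp add: onb_parseval[OF u(1)])
  qed
  then have N: "N > 0" "N\<^sup>2 = (\<Sum>a<d. (cmod (y a))\<^sup>2)" by (auto simp: N_def)
  define v where "v = (\<lambda>a. (1 / of_real N) * y a)"
  have vv: "ip d v v = 1"
    unfolding v_def ip_scale_left ip_scale_right unfolding ip_self N(2)[symmetric]
    using N(1) by (simp add: power2_eq_square)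
  have vu: "ip d v (u i) = 0" if "i < k" for i
    unfolding v_def ip_scale_left using ipy[of i] that Suc.prems by simp
  have uv: "ip d (u i) v = 0" if "i < k" for i using vu[OF that] by (subst ip_commute) simp
  let ?u = "u(k := v)" and ?\<mu> = "\<mu>(k := \<nu>)"
  have "orthonormal_on d {..<Suc k} ?u"
    using vv vu uv ipu Suc.prems by (auto simp: orthonormal_on_def less_Suc_eq)
  moreover have "\<forall>i<Suc k. \<forall>a<d. app d H (?u i) a = ?\<mu> i * ?u i a"
    using eig Hy by (auto simp: less_Suc_eq v_def app_scale simp del: times_divide_eq_left)
  ultimately show ?case by blast
qed

text \<open>The right singular vectors are an eigenbasis of H = X^H X, and \<open>s i\<close> is the
  length of X x_i. The images X x_i are orthogonal because their Gram matrix is diagonal, so the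
  nonzero ones, normalised, serve as left singular vectors.\<close>

lemma svd_exists:
  fixes X :: "nat \<Rightarrow> nat \<Rightarrow> complex"
  shows "\<exists>w x s. onb d w \<and> onb d x \<and> (\<forall>i. 0 \<le> s i) \<and>
    (\<forall>a<d. \<forall>b<d. X a b = (\<Sum>i<d. of_real (s i) * w i a * cnj (x i b)))"
proof -
  define H where "H a b = (\<Sum>c<d. cnj (X c a) * X c b)" for a b
  have "H b a = cnj (H a b)" for a b by (simp add: H_def mult.commute)
  from spectral_partial[of d H d, OF this] obtain x \<mu> where x: "onb d x"
    "\<forall>i<d. \<forall>a<d. app d H (x i) a = \<mu> i * x i a" by auto
  have ipx: "ip d (x i) (x j) = of_bool (i = j)" if "i < d" "j < d" for i j
    using x(1) that by (auto simp: orthonormal_on_def)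
  have HX: "app d H y a = app d (\<lambda>a b. cnj (X b a)) (app d X y) a" for y a
  proof -
    have "app d H y a = (\<Sum>b<d. \<Sum>c<d. cnj (X c a) * (X c b * y b))"
      by (simp add: app_def H_def sum_distrib_right mult.assoc)
    also have "\<dots> = (\<Sum>c<d. \<Sum>b<d. cnj (X c a) * (X c b * y b))" by (rule sum.swap)
    finally show ?thesis by (simp add: app_def sum_distrib_left)
  qed
  have gram: "ip d (app d X (x i)) (app d X (x j)) = \<mu> i * of_bool (i = j)" if "i < d" "j < d" for i j
  proof -
    have "ip d (app d X (x i)) (app d X (x j)) = cnj (ip d (app d X (x j)) (app d X (x i)))"
      by (rule ip_commute)
    also have "\<dots> = cnj (ip d (x j) (app d H (x i)))"
      by (subst ip_app_adjoint) (simp add: HX[abs_def])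
    also have "\<dots> = ip d (app d H (x i)) (x j)" by (rule ip_commute[symmetric])
    also have "\<dots> = ip d (\<lambda>a. \<mu> i * x i a) (x j)" using x(2) that by (intro ip_cong) auto
    finally show ?thesis using that by (simp add: ip_scale_left ipx)
  qed
  define s where "s i = sqrt (\<Sum>a<d. (cmod (app d X (x i) a))\<^sup>2)" for i
  have s0: "0 \<le> s i" for i by (auto simp: s_def intro: sum_nonneg)
  have s2: "of_real ((s i)\<^sup>2) = \<mu> i" if "i < d" for i
    using gram[OF that that] unfolding ip_self s_def by (simp add: sum_nonneg)
  \<comment> \<open>Only nonzero images can be normalised. The left singular vectors at the other
    indices are any orthonormal completion, since they enter with coefficient 0.\<close>
  define J where "J = {i. i < d \<and> s i \<noteq> 0}"
  define w0 where "w0 i a = (1 / of_real (s i)) * app d X (x i) a" for i a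
  have "orthonormal_on d J w0"
  proof (unfold orthonormal_on_def, intro ballI)
    fix i j assume "i \<in> J" "j \<in> J"
    then have ij: "i < d" "j < d" "s i \<noteq> 0" "s j \<noteq> 0" by (auto simp: J_def)
    then show "ip d (w0 i) (w0 j) = of_bool (i = j)"
      unfolding w0_def ip_scale_left ip_scale_right
      by (auto simp: gram s2[symmetric] power2_eq_square)
  qed
  then obtain w where w: "onb d w" "\<forall>i\<in>J. w i = w0 i"
    using orthonormal_on_extend[of J d w0] by (auto simp: J_def)
  have Xx: "app d X (x i) a = of_real (s i) * w i a" if "i < d" "a < d" for i a
  proof (cases "s i = 0")
    case True
    then have "(\<Sum>a<d. (cmod (app d X (x i) a))\<^sup>2) = 0" by (simp add: s_def)
    then have "app d X (x i) a = 0" using that by (subst (asm) sum_nonneg_eq_0_iff) auto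
    then show ?thesis using True by simp
  next
    case False
    then show ?thesis using w(2) that by (auto simp: J_def w0_def)
  qed
  \<comment> \<open>Insert the resolution of the identity on the right of X, which gives X as the
    sum of (X x_i) x_i^H.\<close>
  have "X a b = (\<Sum>i<d. of_real (s i) * w i a * cnj (x i b))" if "a < d" "b < d" for a b
  proof -
    have "(\<Sum>i<d. of_real (s i) * w i a * cnj (x i b)) = (\<Sum>i<d. app d X (x i) a * cnj (x i b))"
      using that by (intro sum.cong) (auto simp: Xx)
    also have "\<dots> = (\<Sum>i<d. \<Sum>c<d. X a c * (x i c * cnj (x i b)))"
      by (simp add: app_def sum_distrib_right mult.assoc)
    also have "\<dots> = (\<Sum>c<d. X a c * (\<Sum>i<d. x i c * cnj (x i b)))"
      by (subst sum.swap) (simp add: sum_distrib_left)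
    also have "\<dots> = (\<Sum>c<d. X a c * of_bool (c = b))"
      using that by (intro sum.cong) (auto simp: onb_complete[OF x(1)])
    also have "\<dots> = X a b" using that by (simp add: of_bool_def if_distrib sum.delta cong: if_cong)
    finally show ?thesis by simp
  qed
  with w(1) x(1) s0 show ?thesis by blast
qed

section \<open>Convexity inequalities\<close>

text \<open>This is Bernoulli's inequality for a real exponent. With y = e^z it follows from two
  uses of 1 + x <= e^x: e^{(r-1)z} >= 1 + (r-1)z, and e^z (1 - z) <= 1.\<close>

lemma powr_ge_tangent:
  fixes y r :: real
  assumes "1 \<le> r" "0 \<le> y"
  shows "1 + r * (y - 1) \<le> y powr r"
proof (cases "y = 0")
  case False
  define z where "z = ln y"
  have y: "y = exp z" "y powr r = exp (r * z)"
    using assms(2) False by (auto simp: z_def powr_def)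
  have "1 \<ge> exp z * (1 - z)"
    using exp_ge_add_one_self[of "- z"] mult_left_mono[of "1 - z" "exp (- z)" "exp z"]
    by (simp flip: exp_add)
  then have 1: "(r - 1) * (exp z * (1 - z)) \<le> (r - 1) * 1"
    using assms(1) by (intro mult_left_mono) auto
  have "exp z * (1 + (r - 1) * z) \<le> exp z * exp ((r - 1) * z)"
    using exp_ge_add_one_self[of "(r - 1) * z"] by (intro mult_left_mono) auto
  also have "\<dots> = exp (r * z)" by (simp add: algebra_simps flip: exp_add)
  finally show ?thesis using 1 unfolding y(2) unfolding y(1) by (simp add: algebra_simps)
qed (use assms in auto)

text \<open>Average the tangent inequality at the points x_i / m, where m is the mean; the linear
  terms cancel. If m = 0, the left-hand side is 0.\<close>

lemma powr_jensen:
  fixes p x :: "'i \<Rightarrow> real"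
  assumes "1 \<le> r" "\<And>i. i \<in> I \<Longrightarrow> 0 \<le> p i" "sum p I = 1" "\<And>i. i \<in> I \<Longrightarrow> 0 \<le> x i"
  shows "(\<Sum>i\<in>I. p i * x i) powr r \<le> (\<Sum>i\<in>I. p i * x i powr r)"
proof -
  define m where "m = (\<Sum>i\<in>I. p i * x i)"
  have m0: "0 \<le> m" using assms by (auto simp: m_def intro!: sum_nonneg)
  show ?thesis
  proof (cases "m = 0")
    case True
    then show ?thesis using assms by (auto simp: m_def intro!: sum_nonneg)
  next
    case False
    with m0 have m: "0 < m" by simp
    have "1 = (\<Sum>i\<in>I. p i * (1 + r * (x i / m - 1)))"
    proof -
      have "(\<Sum>i\<in>I. p i * (1 + r * (x i / m - 1)))
          = (\<Sum>i\<in>I. (1 - r) * p i + (r / m) * (p i * x i))"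
        by (intro sum.cong) (auto simp: algebra_simps)
      also have "\<dots> = (1 - r) * sum p I + (r / m) * m"
        by (simp add: sum.distrib sum_distrib_left m_def)
      finally show ?thesis using m assms(3) by simp
    qed
    also have "\<dots> \<le> (\<Sum>i\<in>I. p i * (x i / m) powr r)"
      using assms m by (intro sum_mono mult_left_mono powr_ge_tangent) auto
    also have "\<dots> = (\<Sum>i\<in>I. p i * x i powr r) / m powr r"
      using assms m by (simp add: sum_divide_distrib powr_divide)
    finally show ?thesis using m by (simp add: m_def[symmetric] field_simps)
  qed
qed

lemma exp_jensen:
  fixes p z :: "'i \<Rightarrow> real"
  assumes "\<And>i. i \<in> I \<Longrightarrow> 0 \<le> p i" "sum p I = 1"
  shows "exp (\<Sum>i\<in>I. p i * z i) \<le> (\<Sum>i\<in>I. p i * exp (z i))"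
proof -
  define m where "m = (\<Sum>i\<in>I. p i * z i)"
  have "(\<Sum>i\<in>I. p i * (exp m * (1 + (z i - m))))
      = exp m * (\<Sum>i\<in>I. (1 - m) * p i + p i * z i)"
    by (simp add: sum_distrib_left algebra_simps)
  also have "\<dots> = exp m * ((1 - m) * sum p I + m)"
    by (simp add: sum.distrib sum_distrib_left m_def)
  finally have "exp m = (\<Sum>i\<in>I. p i * (exp m * (1 + (z i - m))))" using assms(2) by simp
  also have "\<dots> \<le> (\<Sum>i\<in>I. p i * (exp m * exp (z i - m)))"
    using assms(1) exp_ge_add_one_self by (intro sum_mono mult_left_mono) auto
  finally show ?thesis by (simp add: m_def flip: exp_add)
qed

text \<open>With p_i = s_i^{2r} / S, the bracket is ln (n p_i), and its p-mean \<kappa> is the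
  entropy relative to the weight 1/n. Jensen for exp, with the bracket scaled by (1-r)/r, gives
  e^{(1-r)\<kappa>/r} <= (Q/n) (n/S)^{1/r}, where Q is the sum of the s_i^2. The r-th power of this,
  combined with 1 + x <= e^x, is the claim divided by S.\<close>

lemma entropy_power_bound:
  fixes s :: "'i \<Rightarrow> real" and r n :: real
  assumes "finite I" "I \<noteq> {}" "\<And>i. i \<in> I \<Longrightarrow> 0 < s i" "1 \<le> r" "0 < n"
  defines "S \<equiv> \<Sum>i\<in>I. (s i powr r)\<^sup>2"
  shows "S - (r - 1) * (\<Sum>i\<in>I. (s i powr r)\<^sup>2 * (ln ((s i powr r)\<^sup>2) - ln S + ln n))
    \<le> n * ((\<Sum>i\<in>I. (s i)\<^sup>2) / n) powr r"
proof -
  have spos: "0 < s i" "0 < s i powr r" if "i \<in> I" for i using assms(3)[OF that] by auto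
  have S: "0 < S" unfolding S_def using assms(1,2) spos by (intro sum_pos) auto
  define Q where "Q = (\<Sum>i\<in>I. (s i)\<^sup>2)"
  have Q: "0 < Q" unfolding Q_def using assms(1,2) spos by (intro sum_pos) auto
  define p where "p i = (s i powr r)\<^sup>2 / S" for i
  define L where "L i = ln ((s i powr r)\<^sup>2) - ln S + ln n" for i
  define \<kappa> where "\<kappa> = (\<Sum>i\<in>I. p i * L i)"
  have sum_p: "sum p I = 1" using S by (simp add: p_def S_def flip: sum_divide_distrib)
  have p0: "0 \<le> p i" for i using S by (simp add: p_def)
  \<comment> \<open>The factor (1-r)/r is chosen so that p_i (n p_i)^{(1-r)/r} is a multiple of
    p_i^{1/r}, hence of s_i^2.\<close>
  have summand: "p i * exp ((1 - r) / r * L i) = (s i)\<^sup>2 * (exp ((ln n - ln S) / r) / n)"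
    if "i \<in> I" for i
  proof -
    have sp: "ln ((s i powr r)\<^sup>2) = 2 * r * ln (s i)"
      using spos[OF that] by (simp add: ln_powr ln_realpow)
    have p: "p i = exp (2 * r * ln (s i) - ln S)"
      using spos[OF that] S by (simp add: p_def exp_diff flip: sp)
    have s: "(s i)\<^sup>2 = exp (2 * ln (s i))"
      using spos[OF that] by (simp add: exp_double)
    have e: "(2 * r * ln (s i) - ln S) + (1 - r) / r * L i
        = 2 * ln (s i) + (ln n - ln S) / r - ln n"
      unfolding L_def sp using assms(4) by (simp add: field_simps)
    show ?thesis unfolding p s exp_add[symmetric] e using assms(5)
      by (simp add: exp_add exp_diff)
  qed
  have "exp ((1 - r) / r * \<kappa>) = exp (\<Sum>i\<in>I. p i * ((1 - r) / r * L i))"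
    by (simp add: \<kappa>_def sum_distrib_left mult_ac)
  also have "\<dots> \<le> (\<Sum>i\<in>I. p i * exp ((1 - r) / r * L i))"
    using p0 sum_p by (intro exp_jensen)
  also have "\<dots> = (Q / n) * exp ((ln n - ln S) / r)"
  proof -
    have "(\<Sum>i\<in>I. p i * exp ((1 - r) / r * L i)) = (\<Sum>i\<in>I. (s i)\<^sup>2 * (exp ((ln n - ln S) / r) / n))"
      by (rule sum.cong) (use summand in auto)
    then show ?thesis by (simp add: Q_def flip: sum_distrib_right sum_divide_distrib)
  qed
  finally have "exp ((1 - r) / r * \<kappa>) powr r \<le> ((Q / n) * exp ((ln n - ln S) / r)) powr r"
    using assms(4) by (intro powr_mono2) auto
  moreover have "exp ((1 - r) / r * \<kappa>) powr r = exp ((1 - r) * \<kappa>)"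
    using assms(4) by (simp add: powr_def)
  moreover have "((Q / n) * exp ((ln n - ln S) / r)) powr r = (Q / n) powr r * (n / S)"
    using assms(4,5) Q S by (subst powr_mult) (auto simp: powr_def[of "exp _"] exp_diff)
  \<comment> \<open>The exponential is linearised here, because the log-Sobolev inequality supplies
    the entropy only linearly.\<close>
  ultimately have "1 + (1 - r) * \<kappa> \<le> (Q / n) powr r * (n / S)"
    using exp_ge_add_one_self[of "(1 - r) * \<kappa>"] by linarith
  then have "S * (1 + (1 - r) * \<kappa>) \<le> S * ((Q / n) powr r * (n / S))"
    using S by (intro mult_left_mono) auto
  moreover have "S * \<kappa> = (\<Sum>i\<in>I. (s i powr r)\<^sup>2 * L i)"
    using S by (simp add: \<kappa>_def p_def sum_distrib_left)
  ultimately have "S - (r - 1) * (\<Sum>i\<in>I. (s i powr r)\<^sup>2 * L i) \<le> n * (Q / n) powr r"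
  proof -
    assume le: "S * (1 + (1 - r) * \<kappa>) \<le> S * ((Q / n) powr r * (n / S))"
      and \<kappa>: "S * \<kappa> = (\<Sum>i\<in>I. (s i powr r)\<^sup>2 * L i)"
    have "S * (1 + (1 - r) * \<kappa>) = S - (r - 1) * (S * \<kappa>)" by (simp add: algebra_simps)
    then show ?thesis using le S unfolding \<kappa> by (simp add: mult.commute)
  qed
  then show ?thesis by (simp only: Q_def L_def)
qed

text \<open>Gibbs' inequality: ln y <= y - 1 at y = S / (t_i^2 n), with n the number of indices,
  bounds each summand below by t_i^2 - S/n, and these differences add up to 0.\<close>

lemma entropy_nonneg:
  fixes t :: "'i \<Rightarrow> real"
  assumes "finite I" "I \<noteq> {}" "\<And>i. i \<in> I \<Longrightarrow> 0 < t i"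
  shows "0 \<le> (\<Sum>i\<in>I. (t i)\<^sup>2 * (ln ((t i)\<^sup>2) - ln (\<Sum>i\<in>I. (t i)\<^sup>2) + ln (card I)))"
proof -
  define S where "S = (\<Sum>i\<in>I. (t i)\<^sup>2)"
  have S: "0 < S" unfolding S_def using assms by (intro sum_pos zero_less_power)
  have n: "0 < real (card I)" using assms by (simp add: card_gt_0_iff)
  have "(t i)\<^sup>2 - S / card I \<le> (t i)\<^sup>2 * (ln ((t i)\<^sup>2) - ln S + ln (card I))" if "i \<in> I" for i
  proof -
    have t: "0 < t i" using assms(3)[OF that] .
    define y where "y = S / ((t i)\<^sup>2 * card I)"
    have y: "0 < y" using t S n by (simp add: y_def)
    have "ln y = - (ln ((t i)\<^sup>2) - ln S + ln (card I))"
      using t S n by (simp add: y_def ln_div ln_mult)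
    then have "1 - y \<le> ln ((t i)\<^sup>2) - ln S + ln (card I)"
      using ln_le_minus_one[OF y] by linarith
    then have "(t i)\<^sup>2 * (1 - y) \<le> (t i)\<^sup>2 * (ln ((t i)\<^sup>2) - ln S + ln (card I))"
      by (intro mult_left_mono) auto
    moreover have "(t i)\<^sup>2 * y = S / card I" using t by (simp add: y_def)
    ultimately show ?thesis by (simp add: right_diff_distrib)
  qed
  then have "(\<Sum>i\<in>I. (t i)\<^sup>2 - S / card I) \<le> (\<Sum>i\<in>I. (t i)\<^sup>2 * (ln ((t i)\<^sup>2) - ln S + ln (card I)))"
    by (rule sum_mono)
  moreover have "(\<Sum>i\<in>I. (t i)\<^sup>2 - S / card I) = 0"
    using n by (simp add: sum_subtractf S_def)
  ultimately show ?thesis by (simp add: S_def)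
qed

text \<open>Jensen with uniform weights for the exponent p/q >= 1.\<close>

lemma power_mean_le:
  fixes \<sigma> :: "'i \<Rightarrow> real"
  assumes "finite I" "I \<noteq> {}" "\<And>i. i \<in> I \<Longrightarrow> 0 \<le> \<sigma> i" "0 < q" "q \<le> p"
  shows "((\<Sum>i\<in>I. \<sigma> i powr q) / card I) powr (1 / q) \<le> ((\<Sum>i\<in>I. \<sigma> i powr p) / card I) powr (1 / p)"
proof -
  have n: "0 < real (card I)" using assms by (simp add: card_gt_0_iff)
  have "(\<Sum>i\<in>I. 1 / card I * \<sigma> i powr q) powr (p / q) \<le> (\<Sum>i\<in>I. 1 / card I * (\<sigma> i powr q) powr (p / q))"
    using assms n by (intro powr_jensen) auto
  also have "\<dots> = (\<Sum>i\<in>I. \<sigma> i powr p) / card I"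
    using assms by (simp add: powr_powr sum_divide_distrib)
  finally have "((\<Sum>i\<in>I. \<sigma> i powr q) / card I) powr (p / q) \<le> (\<Sum>i\<in>I. \<sigma> i powr p) / card I"
    by (simp add: sum_divide_distrib)
  then have "(((\<Sum>i\<in>I. \<sigma> i powr q) / card I) powr (p / q)) powr (1 / p)
      \<le> ((\<Sum>i\<in>I. \<sigma> i powr p) / card I) powr (1 / p)"
    using assms by (intro powr_mono2) auto
  then show ?thesis using assms by (simp add: powr_powr)
qed

text \<open>Apply the hypothesis to s + \<epsilon> and let \<epsilon> tend to 0 from above.
  Positivity of \<open>r\<close> is what makes \<open>powr\<close> continuous at base 0. The
  log-Sobolev inequality covers positive definite matrices only, so singular X are reached this
  way.\<close>

lemma extend_to_nonneg:
  fixes P :: "'j \<Rightarrow> 'i \<Rightarrow> real" and s :: "'i \<Rightarrow> real"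
  assumes "finite I" "0 < r" "0 < n" "\<And>i. i \<in> I \<Longrightarrow> 0 \<le> s i"
    and pos: "\<And>s. (\<And>i. i \<in> I \<Longrightarrow> 0 < s i) \<Longrightarrow>
      (\<Sum>j\<in>J. (\<Sum>i\<in>I. P j i * s i powr r)\<^sup>2) \<le> n * ((\<Sum>i\<in>I. (s i)\<^sup>2) / n) powr r"
  shows "(\<Sum>j\<in>J. (\<Sum>i\<in>I. P j i * s i powr r)\<^sup>2) \<le> n * ((\<Sum>i\<in>I. (s i)\<^sup>2) / n) powr r"
proof (rule tendsto_le)
  let ?s = "\<lambda>\<epsilon> i. s i + \<epsilon> :: real"
  have lim: "((\<lambda>\<epsilon>. ?s \<epsilon> i) \<longlongrightarrow> s i) (at_right 0)" for i
    using tendsto_add[OF tendsto_const[of "s i"] tendsto_ident_at[of "0::real" "{0<..}"]] by simp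
  show "((\<lambda>\<epsilon>. \<Sum>j\<in>J. (\<Sum>i\<in>I. P j i * ?s \<epsilon> i powr r)\<^sup>2) \<longlongrightarrow> (\<Sum>j\<in>J. (\<Sum>i\<in>I. P j i * s i powr r)\<^sup>2)) (at_right 0)"
    using assms(2,4)
    by (intro tendsto_sum tendsto_power tendsto_mult tendsto_const tendsto_powr' lim)
      (auto intro!: eventually_at_rightI[of 0 1])
  show "((\<lambda>\<epsilon>. n * ((\<Sum>i\<in>I. (?s \<epsilon> i)\<^sup>2) / n) powr r) \<longlongrightarrow> n * ((\<Sum>i\<in>I. (s i)\<^sup>2) / n) powr r) (at_right 0)"
    using assms(2,3)
    by (intro tendsto_mult tendsto_const tendsto_powr' tendsto_divide tendsto_sum tendsto_power lim)
      (auto intro!: eventually_at_rightI[of 0 1] divide_nonneg_nonneg sum_nonneg)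
  show "\<forall>\<^sub>F \<epsilon> in at_right 0. (\<Sum>j\<in>J. (\<Sum>i\<in>I. P j i * ?s \<epsilon> i powr r)\<^sup>2) \<le> n * ((\<Sum>i\<in>I. (?s \<epsilon> i)\<^sup>2) / n) powr r"
    using assms(4) by (intro eventually_at_rightI[of 0 1] pos add_nonneg_pos) auto
qed simp

section \<open>Matrices as sums of dyads\<close>

lemma app_cong: "(\<And>b. b < d \<Longrightarrow> x b = y b) \<Longrightarrow> app d H x a = app d H y a"
  by (simp add: app_def)

text \<open>\<open>eigvals\<close> chooses some list of roots with multiplicity, so its order is
  unknown. Cancelling one common linear factor at a time shows that nothing but the order is left
  open, and sums over the list are determined.\<close>

lemma mset_eq_if_linear_factors_eq:
  fixes as bs :: "'a :: idom list"
  assumes "(\<Prod>a\<leftarrow>as. [:- a, 1:]) = (\<Prod>a\<leftarrow>bs. [:- a, 1:])"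
  shows "mset as = mset bs"
  using assms
proof (induction as arbitrary: bs)
  case Nil
  have "degree (\<Prod>a\<leftarrow>bs. [:- a, 1:]) = length bs"
    by (rule degree_linear_factors)
  with Nil show ?case by (metis degree_1 length_0_conv list.simps(8) mset.simps(1) prod_list.Nil)
next
  case (Cons a as)
  have root: "poly (\<Prod>a\<leftarrow>cs. [:- a, 1:]) x = 0 \<longleftrightarrow> x \<in> set cs" for cs and x :: 'a
    by (induction cs) (auto simp: eq_neg_iff_add_eq_0)
  have "a \<in> set bs" using Cons.prems root[of "a # as" a] root[of bs a] by simp
  then have bs: "mset bs = mset (a # remove1 a bs)" by simp
  have "(\<Prod>a\<leftarrow>bs. [:- a, 1:]) = [:- a, 1:] * (\<Prod>a\<leftarrow>remove1 a bs. [:- a, 1:])"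
  proof -
    have "(\<Prod>a\<leftarrow>bs. f a) = f a * (\<Prod>a\<leftarrow>remove1 a bs. f a)" for f :: "'a \<Rightarrow> 'a poly"
      using \<open>a \<in> set bs\<close> by (induction bs) (auto simp: mult.left_commute)
    then show ?thesis .
  qed
  with Cons.prems have "[:- a, 1:] * (\<Prod>a\<leftarrow>as. [:- a, 1:]) = [:- a, 1:] * (\<Prod>a\<leftarrow>remove1 a bs. [:- a, 1:])"
    by simp
  then have "(\<Prod>a\<leftarrow>as. [:- a, 1:]) = (\<Prod>a\<leftarrow>remove1 a bs. [:- a, 1:])"
    by (simp only: mult_cancel_left) auto
  then show ?case using Cons.IH bs by simp
qed

text \<open>An orthonormal eigenbasis makes \<open>M\<close> similar to the diagonal matrix of the
  \<open>\<mu> i\<close>; the characteristic polynomials agree, and so do the multisets of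
  roots.\<close>

lemma sum_eigvals:
  fixes f :: "complex \<Rightarrow> real"
  assumes "M \<in> carrier_mat d d" "onb d u"
    and eig: "\<And>i a. i < d \<Longrightarrow> a < d \<Longrightarrow> (\<Sum>b<d. M $$ (a,b) * u i b) = \<mu> i * u i a"
  shows "(\<Sum>e\<leftarrow>eigvals M. f e) = (\<Sum>i<d. f (\<mu> i))"
proof -
  let ?V = "mat d d (\<lambda>(a,i). u i a)" and ?W = "mat d d (\<lambda>(i,a). cnj (u i a))"
  let ?D = "mat d d (\<lambda>(i,j). if i = j then \<mu> i else 0)"
  have VW: "?V * ?W = 1\<^sub>m d"
    using onb_complete[OF assms(2)]
    by (intro eq_matI) (auto simp: scalar_prod_def atLeast0LessThan)
  then have WV: "?W * ?V = 1\<^sub>m d"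
    by (intro mat_mult_left_right_inverse[of ?V d ?W]) auto
  have MV: "M * ?V = ?V * ?D"
    using assms(1) eig
    by (intro eq_matI) (auto simp: scalar_prod_def atLeast0LessThan if_distrib sum.delta mult.commute cong: if_cong)
  have "M = M * (?V * ?W)" using assms(1) by (simp add: VW)
  also have "\<dots> = M * ?V * ?W" using assms(1) by (simp add: assoc_mult_mat[of _ d d _ d _ d])
  finally have "M = ?V * ?D * ?W" by (simp add: MV)
  then have "similar_mat M ?D"
    unfolding similar_mat_def similar_mat_wit_def using VW WV assms(1)
    by (intro exI[of _ ?V] exI[of _ ?W]) (auto simp: Let_def)
  then have "char_poly M = char_poly ?D" by (rule char_poly_similar)
  also have "\<dots> = (\<Prod>a\<leftarrow>diag_mat ?D. [:- a, 1:])"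
    by (rule char_poly_upper_triangular[of _ d]) auto
  also have "diag_mat ?D = map \<mu> [0..<d]" by (auto simp: diag_mat_def)
  finally have cp: "char_poly M = (\<Prod>a\<leftarrow>map \<mu> [0..<d]. [:- a, 1:])" .
  have "char_poly M = (\<Prod>a\<leftarrow>eigvals M. [:- a, 1:]) \<and> length (eigvals M) = dim_row M"
    unfolding eigvals_def by (rule someI[of _ "map \<mu> [0..<d]"]) (use cp assms(1) in auto)
  with cp have "mset (eigvals M) = mset (map \<mu> [0..<d])"
    by (intro mset_eq_if_linear_factors_eq) simp
  then have "mset (map f (eigvals M)) = mset (map f (map \<mu> [0..<d]))" by (simp only: mset_map)
  then have "sum_list (map f (eigvals M)) = sum_list (map f (map \<mu> [0..<d]))"
    by (metis sum_mset_sum_list)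
  also have "\<dots> = (\<Sum>i<d. f (\<mu> i))" by (simp add: sum_list_distinct_conv_sum_set atLeast0LessThan comp_def)
  finally show ?thesis .
qed

section \<open>Adjoints, sesquilinear forms and sums of rank-one matrices\<close>

lemma mat_adjoint_carrier [simp]: "A \<in> carrier_mat n m \<Longrightarrow> mat_adjoint A \<in> carrier_mat m n"
  by (auto simp: mat_adjoint_def)

lemma mat_adjoint_dim [simp]:
  "dim_row (mat_adjoint A) = dim_col A" "dim_col (mat_adjoint A) = dim_row A"
  by (auto simp: mat_adjoint_def)

lemma mat_adjoint_index:
  assumes "A \<in> carrier_mat n m" "i < m" "j < n"
  shows "mat_adjoint A $$ (i,j) = cnj (A $$ (j,i))"
  using assms by (auto simp: mat_adjoint_def mat_of_rows_index)

lemma adjoint_eq_iff: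
  assumes "A \<in> carrier_mat d d"
  shows "mat_adjoint A = A \<longleftrightarrow> (\<forall>i<d. \<forall>j<d. cnj (A $$ (j,i)) = A $$ (i,j))"
proof
  assume "mat_adjoint A = A"
  then show "\<forall>i<d. \<forall>j<d. cnj (A $$ (j,i)) = A $$ (i,j)"
    using mat_adjoint_index[OF assms] by metis
next
  assume "\<forall>i<d. \<forall>j<d. cnj (A $$ (j,i)) = A $$ (i,j)"
  then show "mat_adjoint A = A"
    using assms mat_adjoint_carrier[OF assms]
    by (intro eq_matI) (auto simp: mat_adjoint_index[OF assms])
qed

text \<open>This is <A x, y>, linear in \<open>x\<close> and conjugate linear in \<open>y\<close>.
  Written through entries, it makes sense for functions as vectors.\<close>

definition form :: "nat \<Rightarrow> complex mat \<Rightarrow> (nat \<Rightarrow> complex) \<Rightarrow> (nat \<Rightarrow> complex) \<Rightarrow> complex" where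
  "form d A x y = (\<Sum>a<d. \<Sum>b<d. A $$ (a,b) * x b * cnj (y a))"

lemma form_eq_ip: "form d A x y = ip d (app d (\<lambda>a b. A $$ (a,b)) x) y"
  by (simp add: form_def ip_def app_def sum_distrib_right)

lemma cscalar_eq_form:
  assumes "A \<in> carrier_mat d d" "v \<in> carrier_vec d"
  shows "(A *\<^sub>v v) \<bullet>c v = form d A (vec_index v) (vec_index v)"
  using assms by (auto simp: form_eq_ip ip_eq_cscalar_prod[of _ d] ip_def app_def scalar_prod_def atLeast0LessThan)

lemma psd_mat_form:
  "psd_mat d A \<longleftrightarrow> A \<in> carrier_mat d d \<and> mat_adjoint A = A \<and> (\<forall>x. 0 \<le> Re (form d A x x))"
proof -
  have "form d A x x = (A *\<^sub>v vec d x) \<bullet>c vec d x" if "A \<in> carrier_mat d d" for x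
    by (subst cscalar_eq_form[OF that]) (auto simp: form_def)
  then show ?thesis unfolding psd_mat_def using cscalar_eq_form by (metis vec_carrier)
qed

text \<open>One format for the sums of s_i w_i x_i^H that occur: singular value decompositions,
  spectral decompositions (\<open>x = w\<close>), powers such as |X^H|^r (coefficients s_i^r), and a
  single rank-one projection (\<open>n = 1\<close>).\<close>

definition dyads :: "nat \<Rightarrow> nat \<Rightarrow> (nat \<Rightarrow> real) \<Rightarrow> (nat \<Rightarrow> nat \<Rightarrow> complex) \<Rightarrow> (nat \<Rightarrow> nat \<Rightarrow> complex) \<Rightarrow> complex mat" where
  "dyads d n s w x = mat d d (\<lambda>(a,b). \<Sum>i<n. of_real (s i) * w i a * cnj (x i b))"

lemma dyads_carrier [simp]: "dyads d n s w x \<in> carrier_mat d d"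
  by (simp add: dyads_def)

lemma dyads_dim [simp]: "dim_row (dyads d n s w x) = d" "dim_col (dyads d n s w x) = d"
  by (simp_all add: dyads_def)

lemma dyads_index [simp]:
  "a < d \<Longrightarrow> b < d \<Longrightarrow> dyads d n s w x $$ (a,b) = (\<Sum>i<n. of_real (s i) * w i a * cnj (x i b))"
  by (simp add: dyads_def)

lemma svd_mat:
  assumes "X \<in> carrier_mat d d"
  shows "\<exists>w x s. onb d w \<and> onb d x \<and> (\<forall>i. 0 \<le> s i) \<and> X = dyads d d s w x"
proof -
  obtain w x s where wx: "onb d w" "onb d x" "\<forall>i. 0 \<le> s i"
    "\<forall>a<d. \<forall>b<d. X $$ (a,b) = (\<Sum>i<d. of_real (s i) * w i a * cnj (x i b))"
    using svd_exists[of d "\<lambda>a b. X $$ (a,b)"] by blast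
  then have "X = dyads d d s w x" using assms by (intro eq_matI) auto
  with wx show ?thesis by blast
qed

lemma mat_adjoint_dyads: "mat_adjoint (dyads d n s w x) = dyads d n s x w"
proof (rule eq_matI)
  fix i j assume "i < dim_row (dyads d n s x w)" "j < dim_col (dyads d n s x w)"
  then have "i < d" "j < d" by auto
  then show "mat_adjoint (dyads d n s w x) $$ (i,j) = dyads d n s x w $$ (i,j)"
    by (simp add: mat_adjoint_index[OF dyads_carrier] mult.commute mult.left_commute)
qed auto

lemma app_dyads:
  assumes "a < d"
  shows "app d (\<lambda>a b. dyads d n s w x $$ (a,b)) y a = (\<Sum>i<n. of_real (s i) * ip d y (x i) * w i a)"
proof -
  have "app d (\<lambda>a b. dyads d n s w x $$ (a,b)) y a
      = (\<Sum>b<d. \<Sum>i<n. of_real (s i) * w i a * (y b * cnj (x i b)))"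
    using assms by (simp add: app_def sum_distrib_right) (simp add: mult_ac)
  also have "\<dots> = (\<Sum>i<n. of_real (s i) * ip d y (x i) * w i a)"
    by (subst sum.swap) (simp add: ip_def sum_distrib_left sum_distrib_right mult_ac)
  finally show ?thesis .
qed

lemma form_dyads: "form d (dyads d n s w x) y z = (\<Sum>i<n. of_real (s i) * ip d y (x i) * ip d (w i) z)"
proof -
  have "form d (dyads d n s w x) y z
      = ip d (\<lambda>a. \<Sum>i<n. of_real (s i) * ip d y (x i) * w i a) z"
    unfolding form_eq_ip by (rule ip_cong) (simp_all add: app_dyads)
  then show ?thesis by (simp add: ip_sum_left ip_scale_left)
qed

lemma onb_ip: "onb d u \<Longrightarrow> i < d \<Longrightarrow> j < d \<Longrightarrow> ip d (u i) (u j) = of_bool (i = j)"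
  by (auto simp: orthonormal_on_def)

lemma sum_of_bool_mult [simp]:
  "(j::nat) < d \<Longrightarrow> (\<Sum>i<d. f i * of_bool (j = i)) = (f j :: complex)"
  "(j::nat) < d \<Longrightarrow> (\<Sum>i<d. f i * of_bool (i = j)) = (f j :: complex)"
  by (simp_all add: of_bool_def if_distrib sum.delta sum.delta' cong: if_cong)

lemma app_dyads_basis:
  assumes "onb d x" "a < d" "j < d"
  shows "app d (\<lambda>a b. dyads d d s w x $$ (a,b)) (x j) a = of_real (s j) * w j a"
proof -
  have "app d (\<lambda>a b. dyads d d s w x $$ (a,b)) (x j) a = (\<Sum>i<d. (of_real (s i) * w i a) * of_bool (j = i))"
    unfolding app_dyads[OF assms(2)] using onb_ip[OF assms(1,3)] by (intro sum.cong) auto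
  also have "\<dots> = of_real (s j) * w j a"
    using assms(3) by (rule sum_of_bool_mult)
  finally show ?thesis .
qed

lemma form_dyads_basis:
  assumes "onb d w" "onb d x" "j < d"
  shows "form d (dyads d d s w x) (x j) (w j) = of_real (s j)"
proof -
  have "form d (dyads d d s w x) (x j) (w j) = ip d (\<lambda>a. of_real (s j) * w j a) (w j)"
    unfolding form_eq_ip by (rule ip_cong) (use assms in \<open>auto simp: app_dyads_basis\<close>)
  then show ?thesis using assms by (simp add: ip_scale_left onb_ip)
qed

lemma app_mult_mat:
  assumes "A \<in> carrier_mat d d" "B \<in> carrier_mat d d" "a < d"
  shows "app d (\<lambda>a b. (A * B) $$ (a,b)) y a = app d (\<lambda>a b. A $$ (a,b)) (app d (\<lambda>a b. B $$ (a,b)) y) a"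
proof -
  have "app d (\<lambda>a b. (A * B) $$ (a,b)) y a = (\<Sum>b<d. \<Sum>c<d. A $$ (a,c) * (B $$ (c,b) * y b))"
    using assms by (simp add: app_def scalar_prod_def atLeast0LessThan sum_distrib_right mult.assoc)
  also have "\<dots> = app d (\<lambda>a b. A $$ (a,b)) (app d (\<lambda>a b. B $$ (a,b)) y) a"
    by (subst sum.swap) (simp add: app_def sum_distrib_left)
  finally show ?thesis .
qed

text \<open>X^H X has the eigenbasis x_i with eigenvalues s_i^2, and the prefactor d^{-1/p} turns
  the Schatten norm into the p-th power mean of the singular values.\<close>

lemma wnorm_dyads:
  assumes "onb d w" "onb d x" "0 < d" "\<And>i. 0 \<le> s i" "0 < p"
  shows "wnorm d p (dyads d d s w x) = ((\<Sum>i<d. s i powr p) / d) powr (1 / p)"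
proof -
  let ?X = "dyads d d s w x"
  have "(\<Sum>b<d. (mat_adjoint ?X * ?X) $$ (a,b) * x i b) = of_real ((s i)\<^sup>2) * x i a"
    if "i < d" "a < d" for i a
  proof -
    have "(\<Sum>b<d. (mat_adjoint ?X * ?X) $$ (a,b) * x i b)
        = app d (\<lambda>a b. dyads d d s x w $$ (a,b)) (app d (\<lambda>a b. ?X $$ (a,b)) (x i)) a"
      unfolding mat_adjoint_dyads
      using app_mult_mat[OF dyads_carrier dyads_carrier that(2)] by (simp add: app_def)
    also have "\<dots> = app d (\<lambda>a b. dyads d d s x w $$ (a,b)) (\<lambda>a. of_real (s i) * w i a) a"
      using assms that by (intro app_cong) (rule app_dyads_basis)
    also have "\<dots> = of_real ((s i)\<^sup>2) * x i a"
      using assms that by (simp only: app_scale app_dyads_basis) (simp add: power2_eq_square)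
    finally show ?thesis .
  qed
  then have "(\<Sum>e\<leftarrow>eigvals (mat_adjoint ?X * ?X). (Re e) powr (p/2)) = (\<Sum>i<d. (Re (of_real ((s i)\<^sup>2))) powr (p/2))"
    by (intro sum_eigvals[OF _ assms(2)]) (auto intro!: mult_carrier_mat[of _ d d])
  also have "\<dots> = (\<Sum>i<d. s i powr p)"
  proof (intro sum.cong refl)
    fix i
    have "(Re (of_real ((s i)\<^sup>2))) powr (p/2) = (s i powr 2) powr (p/2)"
      using assms(4)[of i] assms(5) by (cases "s i = 0") (auto simp: powr_numeral)
    then show "(Re (of_real ((s i)\<^sup>2))) powr (p/2) = s i powr p" by (simp add: powr_powr)
  qed
  finally show ?thesis
    using assms(3) by (simp add: wnorm_def powr_divide powr_minus_divide sum_nonneg)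
qed

section \<open>Hilbert--Schmidt norms and positivity\<close>

definition hs_norm2 :: "nat \<Rightarrow> complex mat \<Rightarrow> real" where
  "hs_norm2 d Z = (\<Sum>a<d. \<Sum>b<d. (cmod (Z $$ (a,b)))\<^sup>2)"

text \<open>Parseval, applied to the conjugate of each row of \<open>Z\<close>.\<close>

lemma hs_norm2_onb:
  assumes "onb d u"
  shows "hs_norm2 d Z = (\<Sum>j<d. \<Sum>a<d. (cmod (app d (\<lambda>a b. Z $$ (a,b)) (u j) a))\<^sup>2)"
proof -
  have "hs_norm2 d Z = (\<Sum>a<d. \<Sum>j<d. (cmod (ip d (\<lambda>b. cnj (Z $$ (a,b))) (u j)))\<^sup>2)"
    by (simp add: hs_norm2_def onb_parseval[OF assms])
  also have "\<dots> = (\<Sum>j<d. \<Sum>a<d. (cmod (ip d (\<lambda>b. cnj (Z $$ (a,b))) (u j)))\<^sup>2)"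
    by (rule sum.swap)
  also have "\<dots> = (\<Sum>j<d. \<Sum>a<d. (cmod (app d (\<lambda>a b. Z $$ (a,b)) (u j) a))\<^sup>2)"
  proof -
    have "ip d (\<lambda>b. cnj (Z $$ (a,b))) (u j) = cnj (app d (\<lambda>a b. Z $$ (a,b)) (u j) a)" for a j
      by (simp add: ip_def app_def)
    then show ?thesis by simp
  qed
  finally show ?thesis .
qed

text \<open>|<Z u_j, u_j>|^2 is one term of the Parseval expansion of |Z u_j|^2. This discards the
  off-diagonal part of \<open>Z\<close> in the basis \<open>u\<close>.\<close>

lemma sum_form_le_hs_norm2:
  assumes "onb d u"
  shows "(\<Sum>j<d. (Re (form d Z (u j) (u j)))\<^sup>2) \<le> hs_norm2 d Z"
  unfolding hs_norm2_onb[OF assms]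
proof (rule sum_mono)
  fix j assume j: "j \<in> {..<d}"
  let ?y = "app d (\<lambda>a b. Z $$ (a,b)) (u j)"
  have "(Re (form d Z (u j) (u j)))\<^sup>2 \<le> (cmod (ip d ?y (u j)))\<^sup>2"
    unfolding form_eq_ip by (intro abs_le_square_iff[THEN iffD1]) (simp add: abs_Re_le_cmod)
  also have "\<dots> \<le> (\<Sum>i<d. (cmod (ip d ?y (u i)))\<^sup>2)"
    using j by (intro member_le_sum) auto
  finally show "(Re (form d Z (u j) (u j)))\<^sup>2 \<le> (\<Sum>a<d. (cmod (?y a))\<^sup>2)"
    unfolding onb_parseval[OF assms] .
qed

lemma hs_norm2_dyads:
  assumes "onb d w" "onb d x"
  shows "hs_norm2 d (dyads d d s w x) = (\<Sum>j<d. (s j)\<^sup>2)"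
  unfolding hs_norm2_onb[OF assms(2)]
proof (intro sum.cong refl)
  fix j assume j: "j \<in> {..<d}"
  have "(\<Sum>a<d. (cmod (app d (\<lambda>a b. dyads d d s w x $$ (a,b)) (x j) a))\<^sup>2)
      = (\<Sum>a<d. (s j)\<^sup>2 * (cmod (w j a))\<^sup>2)"
    using j by (intro sum.cong) (auto simp: app_dyads_basis[OF assms(2)] norm_mult power_mult_distrib)
  also have "\<dots> = (s j)\<^sup>2 * (\<Sum>a<d. (cmod (w j a))\<^sup>2)" by (simp add: sum_distrib_left)
  also have "(\<Sum>a<d. (cmod (w j a))\<^sup>2) = 1"
    using onb_ip[OF assms(1), of j j] j unfolding ip_self by (simp flip: of_real_sum of_real_power)
  finally show "(\<Sum>a<d. (cmod (app d (\<lambda>a b. dyads d d s w x $$ (a,b)) (x j) a))\<^sup>2) = (s j)\<^sup>2"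
    by simp
qed

lemma sum_form_eq_mtrace:
  assumes "onb d u" "Z \<in> carrier_mat d d"
  shows "(\<Sum>j<d. form d Z (u j) (u j)) = mtrace Z"
proof -
  have "(\<Sum>j<d. form d Z (u j) (u j)) = (\<Sum>a<d. \<Sum>b<d. \<Sum>j<d. Z $$ (a,b) * (u j b * cnj (u j a)))"
  proof -
    have "(\<Sum>j<d. form d Z (u j) (u j)) = (\<Sum>a<d. \<Sum>j<d. \<Sum>b<d. Z $$ (a,b) * (u j b * cnj (u j a)))"
      unfolding form_def mult.assoc by (rule sum.swap)
    also have "\<dots> = (\<Sum>a<d. \<Sum>b<d. \<Sum>j<d. Z $$ (a,b) * (u j b * cnj (u j a)))"
      by (intro sum.cong refl sum.swap)
    finally show ?thesis .
  qed
  also have "\<dots> = (\<Sum>a<d. \<Sum>b<d. Z $$ (a,b) * of_bool (b = a))"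
    by (intro sum.cong refl) (simp add: onb_complete[OF assms(1)] flip: sum_distrib_left)
  also have "\<dots> = mtrace Z" using assms(2) by (simp add: mtrace_def)
  finally show ?thesis .
qed

lemma mtrace_mult:
  assumes "A \<in> carrier_mat d d" "B \<in> carrier_mat d d"
  shows "mtrace (A * B) = (\<Sum>a<d. \<Sum>b<d. A $$ (a,b) * B $$ (b,a))"
  using assms by (simp add: mtrace_def scalar_prod_def atLeast0LessThan)

lemma mtrace_square_hermitian:
  assumes "A \<in> carrier_mat d d" "mat_adjoint A = A"
  shows "mtrace (A * A) = of_real (hs_norm2 d A)"
  unfolding mtrace_mult[OF assms(1,1)] hs_norm2_def of_real_sum complex_norm_square
  using assms(2) unfolding adjoint_eq_iff[OF assms(1)] by (intro sum.cong refl) (metis lessThan_iff)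

lemma form_dyads_diag:
  "form d (dyads d n s w w) y y = of_real (\<Sum>i<n. s i * (cmod (ip d y (w i)))\<^sup>2)"
  unfolding form_dyads of_real_sum of_real_mult complex_norm_square
  by (simp add: ip_commute[of d _ y] mult.assoc)

section \<open>Positive definite matrices and their entropy in spectral form\<close>

lemma pd_mat_dyads:
  fixes t :: "nat \<Rightarrow> real"
  assumes "onb d w" "\<And>i. i < d \<Longrightarrow> 0 < t i"
  shows "pd_mat d (dyads d d t w w)"
  unfolding pd_mat_def
proof (intro conjI ballI impI)
  fix v :: "complex vec" assume v: "v \<in> carrier_vec d" "v \<noteq> 0\<^sub>v d"
  obtain a where a: "a < d" "v $ a \<noteq> 0"
    using v by (metis carrier_vecD eq_vecI index_zero_vec)
  have "0 < (\<Sum>a<d. (cmod (v $ a))\<^sup>2)" using a by (intro sum_pos2[of _ a]) auto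
  then have "(\<Sum>i<d. (cmod (ip d (vec_index v) (w i)))\<^sup>2) \<noteq> 0"
    using onb_parseval[OF assms(1), of "vec_index v"] by simp
  then obtain i where i: "i < d" "ip d (vec_index v) (w i) \<noteq> 0"
    by (metis (no_types, lifting) lessThan_iff norm_zero sum.neutral zero_power2)
  then have "0 < (\<Sum>i<d. t i * (cmod (ip d (vec_index v) (w i)))\<^sup>2)"
    using assms(2) by (intro sum_pos2[of _ i]) (auto simp: less_imp_le)
  then show "0 < Re ((dyads d d t w w *\<^sub>v v) \<bullet>c v)"
    by (simp add: cscalar_eq_form[OF dyads_carrier v(1)] form_dyads_diag)
qed (auto simp: mat_adjoint_dyads)

lemma pd_mat_spectral:
  assumes "pd_mat d A"
  shows "\<exists>w t. onb d w \<and> (\<forall>i<d. 0 < t i) \<and> A = dyads d d t w w"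
proof -
  have A: "A \<in> carrier_mat d d" "mat_adjoint A = A" using assms by (auto simp: pd_mat_def)
  have "A $$ (b,a) = cnj (A $$ (a,b))" if "a < d" "b < d" for a b
    using A(2) that unfolding adjoint_eq_iff[OF A(1)] by metis
  from spectral_partial[of d "\<lambda>a b. A $$ (a,b)" d, OF this] obtain w \<mu> where w: "onb d w"
    "\<forall>i<d. \<forall>a<d. app d (\<lambda>a b. A $$ (a,b)) (w i) a = \<mu> i * w i a" by auto
  have form: "form d A (w i) (w i) = \<mu> i" if "i < d" for i
  proof -
    have "form d A (w i) (w i) = ip d (\<lambda>a. \<mu> i * w i a) (w i)"
      unfolding form_eq_ip using w(2) that by (intro ip_cong) auto
    then show ?thesis using w(1) that by (simp add: ip_scale_left onb_ip)
  qed
  have form_real: "form d A y y = of_real (Re (form d A y y))" for y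
  proof -
    have "cnj (form d A y y) = (\<Sum>b<d. \<Sum>a<d. cnj (A $$ (a,b)) * cnj (y b) * y a)"
      unfolding form_def by (subst sum.swap) simp
    also have "\<dots> = form d A y y"
      unfolding form_def using A(2) unfolding adjoint_eq_iff[OF A(1)]
      by (intro sum.cong refl) (auto simp: mult_ac)
    finally show ?thesis by (simp add: complex_eq_iff)
  qed
  define t where "t i = Re (\<mu> i)" for i
  have \<mu>: "\<mu> i = of_real (t i)" if "i < d" for i
    using form_real[of "w i"] by (simp add: form[OF that] t_def)
  have "0 < t i" if "i < d" for i
  proof -
    have "vec d (w i) \<noteq> 0\<^sub>v d"
    proof
      assume "vec d (w i) = 0\<^sub>v d"
      then have "w i a = 0" if "a < d" for a using that by (metis index_vec index_zero_vec(1))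
      then have "ip d (w i) (w i) = 0" by (simp add: ip_def)
      then show False using onb_ip[OF w(1) that that] by simp
    qed
    then have "0 < Re ((A *\<^sub>v vec d (w i)) \<bullet>c vec d (w i))"
      using assms unfolding pd_mat_def by (meson vec_carrier)
    then have "0 < Re (form d A (vec_index (vec d (w i))) (vec_index (vec d (w i))))"
      by (simp add: cscalar_eq_form[OF A(1)])
    also have "form d A (vec_index (vec d (w i))) (vec_index (vec d (w i))) = \<mu> i"
      unfolding form[OF that, symmetric] by (simp add: form_def)
    finally show ?thesis by (simp add: t_def)
  qed
  moreover have "A = dyads d d t w w"
  proof (rule eq_matI)
    fix a b assume "a < dim_row (dyads d d t w w)" "b < dim_col (dyads d d t w w)"
    then have ab: "a < d" "b < d" by auto
    have "(\<Sum>i<d. of_real (t i) * w i a * cnj (w i b)) = (\<Sum>i<d. app d (\<lambda>a b. A $$ (a,b)) (w i) a * cnj (w i b))"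
      using w(2) ab by (intro sum.cong) (auto simp: \<mu>)
    also have "\<dots> = (\<Sum>i<d. \<Sum>c<d. A $$ (a,c) * (w i c * cnj (w i b)))"
      by (simp add: app_def sum_distrib_right mult.assoc)
    also have "\<dots> = (\<Sum>c<d. A $$ (a,c) * (\<Sum>i<d. w i c * cnj (w i b)))"
      by (subst sum.swap) (simp add: sum_distrib_left)
    also have "\<dots> = (\<Sum>c<d. A $$ (a,c) * of_bool (c = b))"
      using ab by (intro sum.cong) (auto simp: onb_complete[OF w(1)])
    also have "\<dots> = A $$ (a,b)" using ab by simp
    finally show "A $$ (a,b) = dyads d d t w w $$ (a,b)" using ab by simp
  qed (use A in auto)
  ultimately show ?thesis using w(1) by blast
qed

lemma ent2_dyads:
  assumes "onb d w"
  shows "ent2 d (dyads d d t w w) = 1 / (2 * real d) *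
    (\<Sum>i<d. (t i)\<^sup>2 * (ln ((t i)\<^sup>2) - ln (\<Sum>i<d. (t i)\<^sup>2) + ln (real d)))"
proof -
  have "(\<Sum>b<d. dyads d d t w w $$ (a,b) * w i b) = of_real (t i) * w i a" if "i < d" "a < d" for i a
    using app_dyads_basis[OF assms that(2,1), of t w] by (simp add: app_def)
  from sum_eigvals[OF dyads_carrier assms this]
  show ?thesis
    by (simp add: ent2_def mtrace_square_hermitian[OF dyads_carrier mat_adjoint_dyads]
        hs_norm2_dyads[OF assms assms])
qed

section \<open>Quadratic forms of block matrices\<close>

lemma sum_blocks:
  fixes f :: "nat \<Rightarrow> 'a :: comm_monoid_add"
  shows "(\<Sum>a<n*d. f a) = (\<Sum>i<n. \<Sum>a<d. f (i*d + a))"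
proof -
  have "sum f {m..<m+d} = (\<Sum>a<d. f (m + a))" for m
    using sum.shift_bounds_nat_ivl[of f 0 m d] by (simp add: atLeast0LessThan add.commute)
  then show ?thesis by (simp flip: sum.nat_group)
qed

lemma form_block_mat:
  "form (n*d) (block_mat n d X) z z
    = (\<Sum>i<n. \<Sum>j<n. form d (X i j) (\<lambda>b. z (j*d+b)) (\<lambda>a. z (i*d+a)))"
proof -
  have lt: "i * d + a < n * d" if "i < n" "a < d" for i a
    using that mult_le_mono1[of "Suc i" n d] by simp
  have "form (n*d) (block_mat n d X) z z = (\<Sum>i<n. \<Sum>a<d. \<Sum>j<n. \<Sum>b<d.
      X i j $$ (a,b) * z (j*d+b) * cnj (z (i*d+a)))"
    unfolding form_def sum_blocks
    by (intro sum.cong refl) (auto simp: block_mat_def lt)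
  also have "\<dots> = (\<Sum>i<n. \<Sum>j<n. \<Sum>a<d. \<Sum>b<d.
      X i j $$ (a,b) * z (j*d+b) * cnj (z (i*d+a)))"
    by (intro sum.cong refl sum.swap)
  finally show ?thesis by (simp add: form_def)
qed

text \<open>The block matrix is the sum of s_k V_k V_k^H, where V_k stacks the vectors
  \<open>v 0 k\<close>, ..., \<open>v (N-1) k\<close> on top of each other.\<close>

lemma psd_block_dyads:
  assumes "\<And>k. 0 \<le> s k"
  shows "psd_mat (N*d) (block_mat N d (\<lambda>i j. dyads d n s (v i) (v j)))"
  unfolding psd_mat_form
proof (intro conjI allI)
  let ?M = "block_mat N d (\<lambda>i j. dyads d n s (v i) (v j))"
  show M: "?M \<in> carrier_mat (N*d) (N*d)" by (simp add: block_mat_def)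
  show "mat_adjoint ?M = ?M"
    unfolding adjoint_eq_iff[OF M]
  proof (intro allI impI)
    fix a b assume ab: "a < N*d" "b < N*d"
    then have "a mod d < d" "b mod d < d" by (cases "d = 0"; simp)+
    with ab show "cnj (?M $$ (b,a)) = ?M $$ (a,b)"
      by (simp add: block_mat_def mult_ac)
  qed
  fix z
  \<comment> \<open>\<open>g k\<close> is the inner product of \<open>z\<close> with the stacked
    vector V_k, so the form becomes the sum of s_k |g_k|^2.\<close>
  define g where "g k = (\<Sum>j<N. ip d (\<lambda>b. z (j*d+b)) (v j k))" for k
  have "form (N*d) ?M z z = (\<Sum>i<N. \<Sum>j<N. \<Sum>k<n. of_real (s k) *
      ip d (\<lambda>b. z (j*d+b)) (v j k) * cnj (ip d (\<lambda>b. z (i*d+b)) (v i k)))"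
    unfolding form_block_mat form_dyads by (simp only: ip_commute[symmetric])
  also have "\<dots> = (\<Sum>k<n. \<Sum>i<N. \<Sum>j<N. of_real (s k) *
      ip d (\<lambda>b. z (j*d+b)) (v j k) * cnj (ip d (\<lambda>b. z (i*d+b)) (v i k)))"
    by (subst sum.swap[of _ _ "{..<n}"], subst sum.swap[of _ "{..<n}"]) (intro sum.cong refl sum.swap)
  also have "\<dots> = (\<Sum>k<n. of_real (s k) * (g k * cnj (g k)))"
    by (simp add: g_def sum_distrib_left sum_distrib_right mult_ac)
  also have "\<dots> = of_real (\<Sum>k<n. s k * (cmod (g k))\<^sup>2)"
    unfolding of_real_sum of_real_mult complex_norm_square ..
  finally show "0 \<le> Re (form (N*d) ?M z z)"
    using assms by (auto intro!: sum_nonneg)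
qed

section \<open>Completely positive maps\<close>

lemma linear_map_sum:
  assumes "linear_map d T" "finite I" "\<And>i. i \<in> I \<Longrightarrow> M i \<in> carrier_mat d d" "a < d" "b < d"
  shows "T (mat d d (\<lambda>(a,b). \<Sum>i\<in>I. c i * M i $$ (a,b))) $$ (a,b) = (\<Sum>i\<in>I. c i * T (M i) $$ (a,b))"
  using assms(2,3)
proof (induction I rule: finite_induct)
  case empty
  \<comment> \<open>\<open>linear_map\<close> says nothing directly about the zero matrix, so the
    empty sum is written as 0 times the identity.\<close>
  have 0: "mat d d (\<lambda>(a,b). \<Sum>i\<in>{}. c i * M i $$ (a,b)) = (0::complex) \<cdot>\<^sub>m 1\<^sub>m d"
    by (intro eq_matI) auto
  have 1: "T (0 \<cdot>\<^sub>m 1\<^sub>m d) = 0 \<cdot>\<^sub>m T (1\<^sub>m d)" "T (1\<^sub>m d) \<in> carrier_mat d d"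
    using assms(1) by (auto simp: linear_map_def)
  show ?case unfolding 0 1 using 1 assms(4,5) by simp
next
  case (insert i I)
  let ?S = "\<lambda>I. mat d d (\<lambda>(a,b). \<Sum>i\<in>I. c i * M i $$ (a,b))"
  have M: "M i \<in> carrier_mat d d" using insert by auto
  have S: "?S (insert i I) = c i \<cdot>\<^sub>m M i + ?S I"
    using insert.hyps M by (intro eq_matI) auto
  have TS: "T (c i \<cdot>\<^sub>m M i + ?S I) = c i \<cdot>\<^sub>m T (M i) + T (?S I)"
    "T (M i) \<in> carrier_mat d d" "T (?S I) \<in> carrier_mat d d"
    using assms(1) M by (auto simp: linear_map_def)
  have IH: "T (?S I) $$ (a,b) = (\<Sum>i\<in>I. c i * T (M i) $$ (a,b))"
    by (rule insert.IH) (use insert.prems in auto)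
  have "(c i \<cdot>\<^sub>m T (M i) + T (?S I)) $$ (a,b) = (c i \<cdot>\<^sub>m T (M i)) $$ (a,b) + T (?S I) $$ (a,b)"
    by (rule index_add_mat(1)) (use TS(3) assms(4,5) in auto)
  then show ?case unfolding S TS(1) IH using TS(2) insert.hyps assms(4,5) by simp
qed

abbreviation dyad :: "nat \<Rightarrow> (nat \<Rightarrow> complex) \<Rightarrow> complex mat" where
  "dyad d w \<equiv> dyads d 1 (\<lambda>_. 1) (\<lambda>_. w) (\<lambda>_. w)"

lemma form_map_dyads:
  assumes "linear_map d T"
  shows "form d (T (dyads d n s w w)) y z = (\<Sum>i<n. of_real (s i) * form d (T (dyad d (w i))) y z)"
proof -
  have "dyads d n s w w = mat d d (\<lambda>(a,b). \<Sum>i<n. of_real (s i) * dyad d (w i) $$ (a,b))"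
    by (intro eq_matI) (auto simp: mult.assoc)
  then have "T (dyads d n s w w) $$ (a,b) = (\<Sum>i<n. of_real (s i) * T (dyad d (w i)) $$ (a,b))"
    if "a < d" "b < d" for a b
    using linear_map_sum[OF assms, of "{..<n}" "\<lambda>i. dyad d (w i)" a b "\<lambda>i. of_real (s i)"] that by simp
  then have "form d (T (dyads d n s w w)) y z
      = (\<Sum>a<d. \<Sum>b<d. \<Sum>i<n. of_real (s i) * (T (dyad d (w i)) $$ (a,b) * y b * cnj (z a)))"
    unfolding form_def by (intro sum.cong refl) (simp add: sum_distrib_right mult.assoc)
  also have "\<dots> = (\<Sum>a<d. \<Sum>i<n. \<Sum>b<d. of_real (s i) * (T (dyad d (w i)) $$ (a,b) * y b * cnj (z a)))"
    by (intro sum.cong refl sum.swap)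
  also have "\<dots> = (\<Sum>i<n. \<Sum>a<d. \<Sum>b<d. of_real (s i) * (T (dyad d (w i)) $$ (a,b) * y b * cnj (z a)))"
    by (rule sum.swap)
  finally show ?thesis by (simp add: form_def sum_distrib_left)
qed

lemma dyads_one: "onb d w \<Longrightarrow> dyads d d (\<lambda>_. 1) w w = 1\<^sub>m d"
  by (intro eq_matI) (auto simp: onb_complete)

lemma sum_rotate:
  fixes f :: "'a \<Rightarrow> 'b \<Rightarrow> 'c \<Rightarrow> 'd :: comm_monoid_add"
  shows "(\<Sum>j\<in>B. \<Sum>k\<in>C. \<Sum>l\<in>D. f j k l) = (\<Sum>k\<in>C. \<Sum>l\<in>D. \<Sum>j\<in>B. f j k l)"
  by (rule trans[OF sum.swap sum.cong[OF refl sum.swap]])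

text \<open>This is <T^H T Y, Y> = ||T Y||^2. As \<open>hs_adjoint\<close> is given by its entries
  against matrix units, \<open>Y\<close> is expanded in matrix units and T Y is reassembled from
  their images; Hermiticity of \<open>Y\<close> supplies the conjugate that the bilinear trace
  lacks.\<close>

lemma mtrace_hs_adjoint:
  assumes "linear_map d T" "Y \<in> carrier_mat d d" "mat_adjoint Y = Y"
  shows "mtrace (hs_adjoint d T (T Y) * Y) = of_real (hs_norm2 d (T Y))"
proof -
  have TC: "T A \<in> carrier_mat d d" if "A \<in> carrier_mat d d" for A
    using assms(1) that by (auto simp: linear_map_def)
  have unit: "mat_unit d i j \<in> carrier_mat d d" for i j by (simp add: mat_unit_def)
  define E where "E i j = T (mat_unit d i j)" for i j
  have E: "E i j \<in> carrier_mat d d" for i j by (simp add: E_def TC unit)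
  have Ysum: "Y = mat d d (\<lambda>(a,b). \<Sum>(i,j)\<in>{..<d}\<times>{..<d}. Y $$ (i,j) * mat_unit d i j $$ (a,b))"
  proof (rule eq_matI, goal_cases)
    case (1 a b)
    then have ab: "a < d" "b < d" by auto
    have "(\<Sum>(i,j)\<in>{..<d}\<times>{..<d}. Y $$ (i,j) * mat_unit d i j $$ (a,b))
        = (\<Sum>(i,j)\<in>{..<d}\<times>{..<d}. if (i,j) = (a,b) then Y $$ (i,j) else 0)"
      using ab by (intro sum.cong) (auto simp: mat_unit_def)
    also have "\<dots> = Y $$ (a,b)"
      using ab by (subst sum.mono_neutral_right[of _ "{(a,b)}"]) (auto split: if_splits)
    finally show ?case using ab by simp
  qed (use assms(2) in auto)
  have TY: "T Y $$ (a,b) = (\<Sum>i<d. \<Sum>j<d. Y $$ (i,j) * E i j $$ (a,b))" if "a < d" "b < d" for a b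
  proof -
    have "T Y $$ (a,b) = (\<Sum>p\<in>{..<d}\<times>{..<d}. Y $$ p * T (mat_unit d (fst p) (snd p)) $$ (a,b))"
      using linear_map_sum[OF assms(1), of "{..<d}\<times>{..<d}" "\<lambda>p. mat_unit d (fst p) (snd p)" a b "\<lambda>p. Y $$ p"]
        that unit Ysum by (simp add: case_prod_unfold)
    then show ?thesis by (simp add: sum.cartesian_product case_prod_unfold E_def)
  qed
  have K: "hs_adjoint d T (T Y) $$ (i,j) = (\<Sum>k<d. \<Sum>l<d. cnj (E i j $$ (l,k)) * T Y $$ (l,k))"
    if "i < d" "j < d" for i j
    using that by (simp add: hs_adjoint_def mtrace_mult[OF mat_adjoint_carrier[OF E] TC[OF assms(2)]]
        mat_adjoint_index[OF E] flip: E_def)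
  have "mtrace (hs_adjoint d T (T Y) * Y) = (\<Sum>i<d. \<Sum>j<d. \<Sum>k<d. \<Sum>l<d.
      cnj (Y $$ (i,j)) * cnj (E i j $$ (l,k)) * T Y $$ (l,k))"
  proof -
    have H: "hs_adjoint d T (T Y) \<in> carrier_mat d d" by (simp add: hs_adjoint_def)
    show ?thesis unfolding mtrace_mult[OF H assms(2)]
    proof (intro sum.cong refl)
      fix i j assume "i \<in> {..<d}" "j \<in> {..<d}"
      then have ij: "i < d" "j < d" by auto
      then have Y: "Y $$ (j,i) = cnj (Y $$ (i,j))"
        using assms(3) unfolding adjoint_eq_iff[OF assms(2)] by metis
      show "hs_adjoint d T (T Y) $$ (i,j) * Y $$ (j,i)
          = (\<Sum>k<d. \<Sum>l<d. cnj (Y $$ (i,j)) * cnj (E i j $$ (l,k)) * T Y $$ (l,k))"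
        unfolding K[OF ij] Y by (simp add: sum_distrib_left mult_ac)
    qed
  qed
  also have "\<dots> = (\<Sum>i<d. \<Sum>k<d. \<Sum>l<d. \<Sum>j<d.
      cnj (Y $$ (i,j)) * cnj (E i j $$ (l,k)) * T Y $$ (l,k))"
    by (intro sum.cong refl sum_rotate)
  also have "\<dots> = (\<Sum>k<d. \<Sum>l<d. \<Sum>i<d. \<Sum>j<d.
      cnj (Y $$ (i,j)) * cnj (E i j $$ (l,k)) * T Y $$ (l,k))"
    by (rule sum_rotate)
  also have "\<dots> = (\<Sum>k<d. \<Sum>l<d. cnj (T Y $$ (l,k)) * T Y $$ (l,k))"
    by (intro sum.cong refl) (simp add: TY sum_distrib_right)
  also have "\<dots> = (\<Sum>l<d. \<Sum>k<d. cnj (T Y $$ (l,k)) * T Y $$ (l,k))"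
    by (rule sum.swap)
  also have "\<dots> = of_real (hs_norm2 d (T Y))"
    unfolding hs_norm2_def of_real_sum complex_norm_square by (simp add: mult.commute)
  finally show ?thesis .
qed

text \<open>Both parts read off the positive image of the block matrix of dyads. The first tests it
  on the vector with blocks \<open>\<zeta> i\<close>; the second uses that a positive block matrix
  is Hermitian, so \<open>T\<close> commutes with taking adjoints of these dyad sums.\<close>

lemma completely_positive_dyads:
  fixes N n :: nat and v \<zeta> :: "nat \<Rightarrow> _"
  assumes "completely_positive d T" "\<And>k. 0 \<le> s k"
  shows "0 \<le> Re (\<Sum>i<N. \<Sum>j<N. form d (T (dyads d n s (v i) (v j))) (\<zeta> j) (\<zeta> i))"
    and "\<And>i j a b. i < N \<Longrightarrow> j < N \<Longrightarrow> a < d \<Longrightarrow> b < d \<Longrightarrow>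
      cnj (T (dyads d n s (v j) (v i)) $$ (b,a)) = T (dyads d n s (v i) (v j)) $$ (a,b)"
proof -
  let ?M = "block_mat N d (\<lambda>i j. T (dyads d n s (v i) (v j)))"
  have psd: "psd_mat (N*d) ?M"
    using assms(1) psd_block_dyads[of s N d n v] assms(2) unfolding completely_positive_def
    by (metis dyads_carrier)
  have "0 \<le> Re (form (N*d) ?M (\<lambda>m. \<zeta> (m div d) (m mod d)) (\<lambda>m. \<zeta> (m div d) (m mod d)))"
    using psd unfolding psd_mat_form by blast
  also have "form (N*d) ?M (\<lambda>m. \<zeta> (m div d) (m mod d)) (\<lambda>m. \<zeta> (m div d) (m mod d))
      = (\<Sum>i<N. \<Sum>j<N. form d (T (dyads d n s (v i) (v j))) (\<zeta> j) (\<zeta> i))"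
    unfolding form_block_mat by (simp add: form_def)
  finally show "0 \<le> Re (\<Sum>i<N. \<Sum>j<N. form d (T (dyads d n s (v i) (v j))) (\<zeta> j) (\<zeta> i))" .
  fix i j a b assume lt: "i < N" "j < N" "a < d" "b < d"
  have M: "?M \<in> carrier_mat (N*d) (N*d)" "mat_adjoint ?M = ?M"
    using psd by (auto simp: psd_mat_def)
  have "i * d + a < N * d" "j * d + b < N * d"
    using lt mult_le_mono1[of "Suc i" N d] mult_le_mono1[of "Suc j" N d] by auto
  moreover from this have "cnj (?M $$ (j * d + b, i * d + a)) = ?M $$ (i * d + a, j * d + b)"
    using M(2)[unfolded adjoint_eq_iff[OF M(1)]] by blast
  ultimately show "cnj (T (dyads d n s (v j) (v i)) $$ (b,a)) = T (dyads d n s (v i) (v j)) $$ (a,b)"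
    using lt by (simp add: block_mat_def)
qed

lemma form_scale: "form d A (\<lambda>b. c * x b) (\<lambda>a. e * y a) = c * cnj e * form d A x y"
  by (simp add: form_def sum_distrib_left mult_ac)

lemma form_dyad_nonneg:
  assumes "completely_positive d T"
  shows "0 \<le> Re (form d (T (dyad d w)) y y)"
  using completely_positive_dyads(1)[OF assms, where N = 1 and n = 1 and s = "\<lambda>_. 1" and v = "\<lambda>_ _. w" and \<zeta> = "\<lambda>_. y"] by simp

text \<open>A nonnegative binary quadratic form has a nonnegative determinant.\<close>

lemma square_le_if_form_nonneg:
  fixes A B \<sigma> :: real
  assumes "\<And>a b. 0 \<le> a\<^sup>2 * A - 2 * a * b * \<sigma> + b\<^sup>2 * B"
  shows "\<sigma>\<^sup>2 \<le> A * B"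
proof (cases "B = 0")
  case True
  have "\<sigma> = 0"
  proof (rule ccontr)
    assume "\<sigma> \<noteq> 0"
    \<comment> \<open>With B = 0 the form is A - 2 b \<sigma> at a = 1, and this b makes it equal to
      -1.\<close>
    then show False using assms[of 1 "(A + 1) / (2 * \<sigma>)"] True by simp
  qed
  then show ?thesis using True by simp
next
  case False
  have "0 \<le> B" using assms[of 0 1] by simp
  with False have "0 < B" by simp
  \<comment> \<open>At (a, b) = (B, \<sigma>) the form factors as B (A B - \<sigma>^2).\<close>
  moreover have "0 \<le> B * (A * B - \<sigma>\<^sup>2)"
    using assms[of B \<sigma>] by (simp add: power2_eq_square algebra_simps)
  ultimately show ?thesis by (simp add: zero_le_mult_iff)
qed

text \<open>The block matrix with entries \<open>|X\<^sup>*|, X, X\<^sup>*, |X|\<close> is positive, so 2-positivity of \<open>T\<close> bounds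
  the singular values of \<open>T X\<close> by the diagonals of \<open>T |X\<^sup>*|\<close> and \<open>T |X|\<close>.\<close>

lemma singular_value_bound:
  assumes "completely_positive d T" "\<And>k. 0 \<le> s k"
    and \<sigma>: "form d (T (dyads d n s w x)) v u = of_real \<sigma>"
  shows "\<sigma>\<^sup>2 \<le> Re (form d (T (dyads d n s w w)) u u) * Re (form d (T (dyads d n s x x)) v v)"
proof (rule square_le_if_form_nonneg)
  fix a b :: real
  let ?v = "\<lambda>i::nat. if i = 0 then w else x"
  \<comment> \<open>The block vector (a u, -b v) is tested; the sign turns the two off-diagonal
    blocks into -2 a b \<sigma>.\<close>
  define c where "c = complex_of_real (- b)"
  have c: "cnj c = c" by (simp add: c_def)
  let ?\<zeta> = "\<lambda>(i::nat) k. if i = 0 then of_real a * u k else c * v k"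
  have "form d (T (dyads d n s x w)) u v = cnj (form d (T (dyads d n s w x)) v u)"
  proof -
    have "T (dyads d n s x w) $$ (k,l) = cnj (T (dyads d n s w x) $$ (l,k))" if "k < d" "l < d" for k l
      using completely_positive_dyads(2)[OF assms(1,2), where i = 1 and N = 2 and j = 0 and n = n and v = ?v] that by simp
    then have "form d (T (dyads d n s x w)) u v
        = (\<Sum>k<d. \<Sum>l<d. cnj (T (dyads d n s w x) $$ (l,k) * v k * cnj (u l)))"
      unfolding form_def by (intro sum.cong refl) (auto simp: mult_ac)
    also have "\<dots> = (\<Sum>l<d. \<Sum>k<d. cnj (T (dyads d n s w x) $$ (l,k) * v k * cnj (u l)))"
      by (rule sum.swap)
    finally show ?thesis by (simp add: form_def)
  qed
  then have \<sigma>': "form d (T (dyads d n s x w)) u v = of_real \<sigma>" using \<sigma> by simp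
  have "0 \<le> Re (\<Sum>i<2. \<Sum>j<2. form d (T (dyads d n s (?v i) (?v j))) (?\<zeta> j) (?\<zeta> i))"
    by (rule completely_positive_dyads(1)[OF assms(1,2)])
  also have "(\<Sum>i<2. \<Sum>j<2. form d (T (dyads d n s (?v i) (?v j))) (?\<zeta> j) (?\<zeta> i))
      = of_real (a\<^sup>2) * form d (T (dyads d n s w w)) u u + of_real (- 2 * a * b * \<sigma>)
        + of_real (b\<^sup>2) * form d (T (dyads d n s x x)) v v"
    by (simp add: numeral_2_eq_2 form_scale \<sigma> \<sigma>' c) (simp add: c_def power2_eq_square algebra_simps)
  finally show "0 \<le> a\<^sup>2 * Re (form d (T (dyads d n s w w)) u u) - 2 * a * b * \<sigma>
      + b\<^sup>2 * Re (form d (T (dyads d n s x x)) v v)"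
    by (simp del: of_real_power of_real_mult)
qed

section \<open>Hypercontractivity\<close>

context
  fixes d :: nat and T :: "complex mat \<Rightarrow> complex mat"
  assumes ds: "doubly_stochastic d T" and d: "1 \<le> d"
begin

lemma ds_simps:
  shows ds_linear: "linear_map d T" and ds_cp: "completely_positive d T"
    and ds_mtrace: "X \<in> carrier_mat d d \<Longrightarrow> mtrace (T X) = mtrace X"
    and ds_unit: "T (1\<^sub>m d) = 1\<^sub>m d"
  using ds by (auto simp: doubly_stochastic_def)

lemma ds_carrier: "X \<in> carrier_mat d d \<Longrightarrow> T X \<in> carrier_mat d d"
  using ds_linear by (simp add: linear_map_def)

section \<open>Transition kernels of a doubly stochastic map\<close>

definition kernel :: "(nat \<Rightarrow> nat \<Rightarrow> complex) \<Rightarrow> (nat \<Rightarrow> nat \<Rightarrow> complex) \<Rightarrow> nat \<Rightarrow> nat \<Rightarrow> real" where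
  "kernel w u j i = Re (form d (T (dyad d (w i))) (u j) (u j))"

lemma kernel_nonneg: "0 \<le> kernel w u j i"
  unfolding kernel_def by (rule form_dyad_nonneg[OF ds_cp])

lemma form_map_eq_kernel:
  "Re (form d (T (dyads d d s w w)) (u j) (u j)) = (\<Sum>i<d. kernel w u j i * s i)"
  by (subst form_map_dyads[OF ds_linear]) (simp add: kernel_def mult.commute)

text \<open>The projections onto the w_i add up to the identity, which \<open>T\<close> fixes. The
  other marginal comes instead from preservation of the trace, with the u_j serving to compute
  it.\<close>

lemma kernel_sum_right:
  assumes "onb d w" "onb d u" "j < d"
  shows "(\<Sum>i<d. kernel w u j i) = 1"
proof -
  have "(\<Sum>i<d. kernel w u j i) = Re (form d (T (1\<^sub>m d)) (u j) (u j))"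
    using form_map_eq_kernel[of "\<lambda>_. 1" w u j] by (simp add: dyads_one[OF assms(1)])
  also have "T (1\<^sub>m d) = dyads d d (\<lambda>_. 1) u u"
    by (simp add: ds_unit dyads_one[OF assms(2)])
  finally show ?thesis using form_dyads_basis[OF assms(2,2,3)] by simp
qed

lemma kernel_sum_left:
  assumes "onb d w" "onb d u" "i < d"
  shows "(\<Sum>j<d. kernel w u j i) = 1"
proof -
  have "(\<Sum>j<d. kernel w u j i) = Re (mtrace (T (dyad d (w i))))"
    by (simp add: kernel_def ds_carrier flip: sum_form_eq_mtrace[OF assms(2)])
  also have "mtrace (T (dyad d (w i))) = mtrace (dyad d (w i))" by (rule ds_mtrace) simp
  also have "\<dots> = ip d (w i) (w i)" by (simp add: mtrace_def ip_def)
  finally show ?thesis using onb_ip[OF assms(1,3,3)] by simp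
qed

lemma kernel_jensen:
  assumes "onb d w" "onb d u" "j < d" "1 \<le> r" "\<And>i. i < d \<Longrightarrow> 0 \<le> s i"
  shows "(\<Sum>i<d. kernel w u j i * s i) powr r \<le> (\<Sum>i<d. kernel w u j i * s i powr r)"
  using assms by (intro powr_jensen) (auto simp: kernel_nonneg kernel_sum_right)

text \<open>Jensen for the square along each row, then column sums equal to 1.\<close>

lemma kernel_contraction:
  assumes "onb d w" "onb d u" "\<And>i. i < d \<Longrightarrow> 0 \<le> t i"
  shows "(\<Sum>j<d. (\<Sum>i<d. kernel w u j i * t i)\<^sup>2) \<le> (\<Sum>i<d. (t i)\<^sup>2)"
proof -
  have "(\<Sum>j<d. (\<Sum>i<d. kernel w u j i * t i)\<^sup>2) \<le> (\<Sum>j<d. \<Sum>i<d. kernel w u j i * (t i)\<^sup>2)"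
  proof (rule sum_mono)
    fix j assume "j \<in> {..<d}"
    then have "(\<Sum>i<d. kernel w u j i * t i) powr 2 \<le> (\<Sum>i<d. kernel w u j i * t i powr 2)"
      using assms by (intro kernel_jensen) auto
    moreover have "(\<Sum>i<d. kernel w u j i * t i powr 2) = (\<Sum>i<d. kernel w u j i * (t i)\<^sup>2)"
      using assms(3) by (intro sum.cong) auto
    moreover have "0 \<le> (\<Sum>i<d. kernel w u j i * t i)"
      using assms(3) by (auto intro!: sum_nonneg simp: kernel_nonneg)
    ultimately show "(\<Sum>i<d. kernel w u j i * t i)\<^sup>2 \<le> (\<Sum>i<d. kernel w u j i * (t i)\<^sup>2)"
      by simp
  qed
  also have "\<dots> = (\<Sum>i<d. \<Sum>j<d. kernel w u j i * (t i)\<^sup>2)" by (rule sum.swap)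
  also have "\<dots> = (\<Sum>i<d. (t i)\<^sup>2)"
    using assms by (intro sum.cong refl) (simp add: kernel_sum_left flip: sum_distrib_right)
  finally show ?thesis .
qed

lemma singular_value_kernel_bound:
  assumes "onb d u" "onb d v" "\<And>i. 0 \<le> s i" "T (dyads d d s w x) = dyads d d \<sigma> u v" "j < d"
  shows "(\<sigma> j)\<^sup>2 \<le> (\<Sum>i<d. kernel w u j i * s i) * (\<Sum>i<d. kernel x v j i * s i)"
proof -
  have "form d (T (dyads d d s w x)) (v j) (u j) = of_real (\<sigma> j)"
    unfolding assms(4) by (rule form_dyads_basis[OF assms(1,2,5)])
  from singular_value_bound[OF ds_cp assms(3) this] show ?thesis
    by (simp add: form_map_eq_kernel)
qed

text \<open>The singular values of the image satisfy \<sigma>_j^2 <= A_j B_j with two kernel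
  averages of \<open>t\<close>. The arithmetic-geometric mean inequality separates them, and each
  kernel contracts. The result makes the Dirichlet form nonnegative.\<close>

lemma hs_norm2_map_dyads:
  assumes "onb d w" "\<And>i. 0 \<le> t i"
  shows "hs_norm2 d (T (dyads d d t w w)) \<le> (\<Sum>i<d. (t i)\<^sup>2)"
proof -
  obtain u v \<sigma> where uv: "onb d u" "onb d v" "T (dyads d d t w w) = dyads d d \<sigma> u v"
    using svd_mat[OF ds_carrier[OF dyads_carrier]] by blast
  let ?A = "\<lambda>j. \<Sum>i<d. kernel w u j i * t i" and ?B = "\<lambda>j. \<Sum>i<d. kernel w v j i * t i"
  have "hs_norm2 d (T (dyads d d t w w)) = (\<Sum>j<d. (\<sigma> j)\<^sup>2)"
    by (simp add: uv hs_norm2_dyads)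
  also have "\<dots> \<le> (\<Sum>j<d. ((?A j)\<^sup>2 + (?B j)\<^sup>2) / 2)"
  proof (rule sum_mono)
    fix j assume "j \<in> {..<d}"
    then have "(\<sigma> j)\<^sup>2 \<le> ?A j * ?B j"
      using assms uv by (intro singular_value_kernel_bound) auto
    then show "(\<sigma> j)\<^sup>2 \<le> ((?A j)\<^sup>2 + (?B j)\<^sup>2) / 2"
      using sum_squares_bound[of "?A j" "?B j"] by simp
  qed
  also have "\<dots> = ((\<Sum>j<d. (?A j)\<^sup>2) + (\<Sum>j<d. (?B j)\<^sup>2)) / 2"
    by (simp add: sum.distrib flip: sum_divide_distrib)
  also have "\<dots> \<le> (\<Sum>i<d. (t i)\<^sup>2)"
    using kernel_contraction[OF assms(1) uv(1), of t] kernel_contraction[OF assms(1) uv(2), of t] assms(2)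
    by simp
  finally show ?thesis .
qed

section \<open>The Dirichlet form and the log-Sobolev inequality\<close>

abbreviation gen :: "complex mat \<Rightarrow> complex mat" where
  "gen X \<equiv> hs_adjoint d T (T X) - X"

lemma dirichlet2_dyads:
  assumes "onb d w"
  shows "dirichlet2 d gen (dyads d d t w w)
    = ((\<Sum>i<d. (t i)\<^sup>2) - hs_norm2 d (T (dyads d d t w w))) / real d"
proof -
  let ?Y = "dyads d d t w w"
  have C: "hs_adjoint d T (T ?Y) \<in> carrier_mat d d" by (simp add: hs_adjoint_def)
  have "mtrace (gen ?Y * ?Y) = mtrace (hs_adjoint d T (T ?Y) * ?Y) - mtrace (?Y * ?Y)"
    using C minus_carrier_mat[OF dyads_carrier[of d d t w w], of "hs_adjoint d T (T ?Y)"]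
    by (simp add: mtrace_mult[of _ d] left_diff_distrib sum_subtractf del: dyads_index)
  then show ?thesis
    by (simp add: dirichlet2_def mtrace_hs_adjoint[OF ds_linear dyads_carrier mat_adjoint_dyads]
        mtrace_square_hermitian[OF dyads_carrier mat_adjoint_dyads]
        hs_norm2_dyads[OF assms assms] diff_divide_distrib)
qed

lemma dirichlet2_nonneg:
  assumes "onb d w" "\<And>i. 0 \<le> t i"
  shows "0 \<le> dirichlet2 d gen (dyads d d t w w)"
  using hs_norm2_map_dyads[OF assms] by (simp add: dirichlet2_dyads assms)

text \<open>A real infimum lies below the members of its set only if the set is bounded below; here
  0 is a bound, as the Dirichlet form and the entropy are both nonnegative. Where the entropy
  vanishes, no quotient is in the set, and the claim is nonnegativity of the Dirichlet form.\<close>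

lemma log_sobolev:
  assumes "pd_mat d X"
  shows "alpha2 d gen * ent2 d X \<le> dirichlet2 d gen X"
proof -
  have nonneg: "0 \<le> dirichlet2 d gen X \<and> 0 \<le> ent2 d X" if pd: "pd_mat d X" for X
  proof -
    obtain w t where wt: "onb d w" "\<And>i. i < d \<Longrightarrow> 0 < t i" "X = dyads d d t w w"
      using pd_mat_spectral[OF pd] by blast
    \<comment> \<open>The spectral values are known to be positive only below \<open>d\<close>;
      padding with 0 makes them nonnegative at all indices without changing the matrix.\<close>
    define t' where "t' i = (if i < d then t i else 0)" for i
    have "X = dyads d d t' w w" unfolding wt(3) by (intro eq_matI) (auto simp: t'_def)
    moreover have "0 \<le> t' i" for i using wt(2)[of i] by (simp add: t'_def less_imp_le)
    moreover have "0 \<le> ent2 d (dyads d d t w w)"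
      using entropy_nonneg[of "{..<d}" t] wt(2) d by (simp add: ent2_dyads[OF wt(1)] lessThan_empty_iff)
    ultimately show ?thesis using dirichlet2_nonneg[OF wt(1)] wt(3) by auto
  qed
  show ?thesis
  proof (cases "ent2 d X = 0")
    case True
    then show ?thesis using nonneg[OF assms] by simp
  next
    case False
    let ?S = "{dirichlet2 d gen X / ent2 d X | X. pd_mat d X \<and> ent2 d X \<noteq> 0}"
    have "bdd_below ?S" using nonneg by (intro bdd_belowI[of _ 0]) (auto intro!: divide_nonneg_nonneg)
    then have "alpha2 d gen \<le> dirichlet2 d gen X / ent2 d X"
      unfolding alpha2_def using assms False by (intro cInf_lower) auto
    then show ?thesis using nonneg[OF assms] False by (simp add: field_simps)
  qed
qed

text \<open>The choice \<open>2 r \<le> 2 + \<alpha>\<^sub>2\<close> makes the entropy gained from the log-Sobolev inequality for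
  \<open>Y = |X|\<^sup>r\<close> pay exactly for comparing \<open>tr Y\<^sup>2 = tr |X|\<^sup>2\<^sup>r\<close> with the 2-norm of \<open>X\<close>.\<close>

lemma kernel_hypercontractive_pos:
  assumes "onb d w" "onb d u" "\<And>i. i < d \<Longrightarrow> 0 < s i"
    and r: "r = 1 \<or> 1 \<le> r \<and> 2 * r \<le> 2 + alpha2 d gen"
  shows "(\<Sum>j<d. (\<Sum>i<d. kernel w u j i * s i powr r)\<^sup>2) \<le> d * ((\<Sum>i<d. (s i)\<^sup>2) / d) powr r"
proof (cases "r = 1")
  case True
  have "(\<Sum>i<d. kernel w u j i * s i powr 1) = (\<Sum>i<d. kernel w u j i * s i)" for j
    using assms(3) by (intro sum.cong) (auto simp: less_imp_le)
  moreover have "(\<Sum>j<d. (\<Sum>i<d. kernel w u j i * s i)\<^sup>2) \<le> (\<Sum>i<d. (s i)\<^sup>2)"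
    using assms(3) by (intro kernel_contraction assms(1,2)) (simp add: less_imp_le)
  moreover have "0 \<le> (\<Sum>i<d. (s i)\<^sup>2) / d" by (auto intro!: divide_nonneg_nonneg sum_nonneg)
  ultimately show ?thesis using True d by simp
next
  case False
  with r have r: "1 \<le> r" "2 * r \<le> 2 + alpha2 d gen" by auto
  let ?t = "\<lambda>i. s i powr r"
  let ?Y = "dyads d d ?t w w"
  define S where "S = (\<Sum>i<d. (?t i)\<^sup>2)"
  define K where "K = (\<Sum>i<d. (?t i)\<^sup>2 * (ln ((?t i)\<^sup>2) - ln S + ln (real d)))"
  have t: "0 < ?t i" if "i < d" for i using assms(3)[OF that] by simp
  have K: "0 \<le> K"
    using entropy_nonneg[of "{..<d}" ?t] t d by (simp add: K_def S_def lessThan_empty_iff)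
  have "alpha2 d gen * (K / (2 * real d)) \<le> (S - hs_norm2 d (T ?Y)) / real d"
    using log_sobolev[OF pd_mat_dyads[OF assms(1) t]]
    unfolding ent2_dyads[OF assms(1)] dirichlet2_dyads[OF assms(1)] by (simp add: S_def K_def)
  then have "hs_norm2 d (T ?Y) \<le> S - alpha2 d gen / 2 * K"
    using d by (simp add: field_simps)
  \<comment> \<open>The factor 1/(2d) in the entropy against 1/d in the Dirichlet form leaves
    \<open>alpha2\<close> / 2 in front of K. This is at least r - 1 by the bound on r, and K is
    nonnegative.\<close>
  also have "\<dots> \<le> S - (r - 1) * K"
    using r K by (intro diff_left_mono mult_right_mono) auto
  also have "\<dots> \<le> d * ((\<Sum>i<d. (s i)\<^sup>2) / d) powr r"
    unfolding S_def K_def using d assms(3) r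
    by (intro entropy_power_bound) (auto simp: lessThan_empty_iff)
  finally show ?thesis
    using sum_form_le_hs_norm2[OF assms(2), of "T ?Y"] by (simp add: form_map_eq_kernel)
qed

lemma kernel_hypercontractive:
  assumes "onb d w" "onb d u" "\<And>i. 0 \<le> s i"
    and "r = 1 \<or> 1 \<le> r \<and> 2 * r \<le> 2 + alpha2 d gen"
  shows "(\<Sum>j<d. (\<Sum>i<d. kernel w u j i * s i powr r)\<^sup>2) \<le> d * ((\<Sum>i<d. (s i)\<^sup>2) / d) powr r"
proof (rule extend_to_nonneg)
  show "0 < r" using assms(4) by auto
  show "(\<Sum>j<d. (\<Sum>i<d. kernel w u j i * s i powr r)\<^sup>2) \<le> d * ((\<Sum>i<d. (s i)\<^sup>2) / d) powr r"
    if "\<And>i. i \<in> {..<d} \<Longrightarrow> 0 < s i" for s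
    by (rule kernel_hypercontractive_pos[OF assms(1,2) _ assms(4)]) (use that in auto)
qed (use assms(3) d in auto)

text \<open>The alternative \<open>q = 2\<close> is listed separately so that contraction of the
  2-norm is available whatever the value of \<open>alpha2\<close>.\<close>

lemma wnorm_map_le:
  assumes "X \<in> carrier_mat d d" "q = 2 \<or> 2 \<le> q \<and> q \<le> 2 + alpha2 d gen"
  shows "wnorm d q (T X) \<le> wnorm d 2 X"
proof -
  obtain w x s where X: "onb d w" "onb d x" "\<And>i. 0 \<le> s i" "X = dyads d d s w x"
    using svd_mat[OF assms(1)] by blast
  obtain u v \<sigma> where TX: "onb d u" "onb d v" "\<And>i. 0 \<le> \<sigma> i" "T X = dyads d d \<sigma> u v"
    using svd_mat[OF ds_carrier[OF assms(1)]] by blast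
  define r where "r = q / 2"
  have r: "r = 1 \<or> 1 \<le> r \<and> 2 * r \<le> 2 + alpha2 d gen" "1 \<le> r" "q = 2 * r"
    using assms(2) by (auto simp: r_def)
  define R where "R = d * ((\<Sum>i<d. (s i)\<^sup>2) / d) powr r"
  let ?A = "\<lambda>r j. \<Sum>i<d. kernel w u j i * s i powr r" and ?B = "\<lambda>r j. \<Sum>i<d. kernel x v j i * s i powr r"
  have nonneg: "0 \<le> ?A r j" "0 \<le> ?B r j" for r j
    by (auto intro!: sum_nonneg simp: kernel_nonneg)
  have "(\<Sum>j<d. \<sigma> j powr q) \<le> (\<Sum>j<d. ((?A r j)\<^sup>2 + (?B r j)\<^sup>2) / 2)"
  proof (rule sum_mono)
    fix j assume j: "j \<in> {..<d}"
    have "\<sigma> j powr q = ((\<sigma> j)\<^sup>2) powr r"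
      using TX(3)[of j] by (simp add: r(3) powr_powr flip: powr_numeral)
    also have "\<dots> \<le> (?A 1 j * ?B 1 j) powr r"
      using singular_value_kernel_bound[OF TX(1,2) X(3), where w = w and x = x and \<sigma> = \<sigma> and j = j] X(3,4) TX(4) j r(2)
      by (intro powr_mono2) auto
    also have "\<dots> = ?A 1 j powr r * ?B 1 j powr r" by (simp add: powr_mult nonneg)
    also have "\<dots> \<le> ?A r j * ?B r j"
    proof (rule mult_mono)
      show "?A 1 j powr r \<le> ?A r j"
        using kernel_jensen[OF X(1) TX(1), of j r s] j r(2) X(3) by simp
      show "?B 1 j powr r \<le> ?B r j"
        using kernel_jensen[OF X(2) TX(2), of j r s] j r(2) X(3) by simp
    qed (auto simp: nonneg)
    \<comment> \<open>The kernels of (w, u) and (x, v) are separated here, so that each can be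
      bounded by itself.\<close>
    also have "\<dots> \<le> ((?A r j)\<^sup>2 + (?B r j)\<^sup>2) / 2"
      using sum_squares_bound[of "?A r j" "?B r j"] by simp
    finally show "\<sigma> j powr q \<le> ((?A r j)\<^sup>2 + (?B r j)\<^sup>2) / 2" .
  qed
  also have "\<dots> = ((\<Sum>j<d. (?A r j)\<^sup>2) + (\<Sum>j<d. (?B r j)\<^sup>2)) / 2"
    by (simp add: sum.distrib flip: sum_divide_distrib)
  \<comment> \<open>The bound R depends on the singular values of X alone and not on the bases, so
    it serves both kernels.\<close>
  also have "\<dots> \<le> R"
  proof -
    have "(p + q') / 2 \<le> R" if "p \<le> R" "q' \<le> R" for p q' using that by simp
    then show ?thesis
      using kernel_hypercontractive[OF X(1) TX(1), of s, OF X(3) r(1)]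
        kernel_hypercontractive[OF X(2) TX(2), of s, OF X(3) r(1)]
      unfolding R_def by blast
  qed
  finally have "(\<Sum>j<d. \<sigma> j powr q) / d \<le> ((\<Sum>i<d. (s i)\<^sup>2) / d) powr r"
    using d by (simp add: R_def divide_le_eq mult.commute)
  then have "((\<Sum>j<d. \<sigma> j powr q) / d) powr (1 / q) \<le> (((\<Sum>i<d. (s i)\<^sup>2) / d) powr r) powr (1 / q)"
    using r by (intro powr_mono2) (auto intro!: divide_nonneg_nonneg sum_nonneg)
  \<comment> \<open>The exponents combine to r / q = 1/2.\<close>
  also have "\<dots> = ((\<Sum>i<d. s i powr 2) / d) powr (1 / 2)"
    using r X(3) by (simp add: powr_powr)
  finally show ?thesis
    using d r X TX by (simp add: wnorm_dyads)
qed

text \<open>The weighted norms are power means of singular values, hence increasing in the exponent,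
  and the case q = 2 bounds the largest of them.\<close>

lemma wnorm_map_le_small:
  assumes "X \<in> carrier_mat d d" "0 < q" "q \<le> 2"
  shows "wnorm d q (T X) \<le> wnorm d 2 X"
proof -
  obtain u v \<sigma> where TX: "onb d u" "onb d v" "\<And>i. 0 \<le> \<sigma> i" "T X = dyads d d \<sigma> u v"
    using svd_mat[OF ds_carrier[OF assms(1)]] by blast
  have "wnorm d q (T X) \<le> wnorm d 2 (T X)"
    using power_mean_le[of "{..<d}" \<sigma> q 2] TX d assms
    by (simp add: wnorm_dyads lessThan_empty_iff)
  also have "\<dots> \<le> wnorm d 2 X" by (rule wnorm_map_le[OF assms(1)]) simp
  finally show ?thesis .
qed

end

theorem mainTheorem15:
  fixes d :: nat and T :: "complex mat \<Rightarrow> complex mat" and q :: real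
  assumes "d \<ge> 1"
    and "doubly_stochastic d T"
    and "primitive d (hs_adjoint d T \<circ> T)"
    and "0 < q" and "q \<le> 2 + 2 * alphaD d T"
  shows "norm_2_to_q d q T \<le> 1"
proof -
  have le: "wnorm d q (T X) \<le> wnorm d 2 X" if "X \<in> carrier_mat d d" for X
  proof (cases "q \<le> 2")
    case True
    then show ?thesis using wnorm_map_le_small[OF assms(2,1) that assms(4)] by simp
  next
    case False
    \<comment> \<open>\<open>alphaD\<close> is half of \<open>alpha2\<close> for T^H T - id, so 2 +
      2 \<open>alphaD\<close> is the bound 2 + \<open>alpha2\<close> used above.\<close>
    then show ?thesis using wnorm_map_le[OF assms(2,1) that, of q] assms(5) by (simp add: alphaD_def)
  qed
  have "0 \<le> wnorm d 2 X" for X by (simp add: wnorm_def)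
  \<comment> \<open>A zero denominator makes the quotient 0 by the convention for division, so no
    lower bound on the 2-norm is required.\<close>
  then have "wnorm d q (T X) / wnorm d 2 X \<le> 1" if "X \<in> carrier_mat d d" for X
    using le[OF that] by (metis divide_le_eq_1 order_le_less)
  \<comment> \<open>The identity is a nonzero matrix as \<open>d\<close> is positive; it shows that
    the supremum is taken over a nonempty set.\<close>
  moreover have "1\<^sub>m d \<noteq> (0\<^sub>m d d :: complex mat)"
    using assms(1) by (metis index_one_mat(1) index_zero_mat(1) less_eq_Suc_le One_nat_def zero_neq_one)
  ultimately show ?thesis
    unfolding norm_2_to_q_def by (intro cSup_least) (auto intro!: exI[of _ "1\<^sub>m d"])
qed

end
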